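(* Let $(M^n,g)$ be a perfect fluid spacetime with velocity vector field $\rho$, energy density $\sigma$ and isotropic pressure $p$. Suppose that it admits a $k$-almost Yamabe soliton $(g,\rho,k,\lambda)$ whose potential vector field is the velocity vector field $\rho$. Then: (i) the integral curves of $\rho$ are geodesics; (ii) the spacetime is stationary; (iii) $\sigma$ and $p$ are invariant under $\rho$, that is, $\pounds_\rho \sigma=0$ and $\pounds_\rho p=0$.
   Context: $(M^n,g)$ is a Lorentzian manifold, $n\ge 3$, with metric $g$ of signature $(-,+,\ldots,+)$, Levi-Civita connection $\nabla$, Ricci tensor $S$ and scalar curvature $R$. $\pounds$ denotes the Lie derivative. Perfect fluid spacetime: a Lorentzian manifold whose Ricci tensor is non-vanishing and satisfies $S=\alpha g+\beta\, C\otimes C$, where $\alpha,\beta$ are scalar functions (not simultaneously zero), $C$ is the 1-form $C(X)=g(X,\rho)$ for all vector fields $X$, and $\rho$ is the velocity vector field, which is unit timelike: $g(\rho,\rho)=-1$. The spacetime obeys the Einstein field equations without cosmological constant, $S-\frac{R}{2}g=\kappa T$, where $\kappa$ is the (nonzero) gravitational constant and $T=(p+\sigma)C\otimes C+p\,g$ is the energy-momentum tensor, with $p$ the isotropic pressure and $\sigma$ the energy density; consequently $\alpha=\frac{\kappa(p-\sigma)}{2-n}$ and $\beta=\kappa(p+\sigma)$. $k$-almost Yamabe soliton $(g,Z,k,\lambda)$: a smooth vector field $Z$ (the potential vector field), a nowhere vanishing smooth function $k$ and a smooth function $\lambda$ on $M$ such that $\frac{k}{2}\pounds_Z g=(R-\lambda)g$.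 A spacetime is stationary if it admits a timelike Killing vector field. *)

theory Defs
  imports "HOL-Analysis.Analysis"
begin

section \<open>Smooth maps between open subsets of normed spaces\<close>

text \<open>In finite dimension and on open \<open>S\<close>, this is the usual notion of \<open>C\<^sup>k\<close>: all iterated directional
  derivatives up to order \<open>k\<close> exist and are continuous. It is only meant for open \<open>S\<close>.\<close>

primrec Ck_on :: "nat \<Rightarrow> 'a set \<Rightarrow> ('a::real_normed_vector \<Rightarrow> 'b::real_normed_vector) \<Rightarrow> bool" where
  "Ck_on 0 S f \<longleftrightarrow> continuous_on S f"
| "Ck_on (Suc k) S f \<longleftrightarrow>
     (\<forall>x\<in>S. f differentiable (at x)) \<and> (\<forall>v. Ck_on k S (\<lambda>x. frechet_derivative f (at x) v))"

definition smooth_on :: "'a set \<Rightarrow> ('a::real_normed_vector \<Rightarrow> 'b::real_normed_vector) \<Rightarrow> bool" where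
  "smooth_on S f \<longleftrightarrow> (\<forall>k. Ck_on k S f)"

section \<open>Local pseudo-Riemannian calculus on open subsets of \<open>\<real>\<^sup>n\<close>\<close>

text \<open>Here vector fields are maps \<open>\<real>\<^sup>n \<rightarrow> \<real>\<^sup>n\<close> and a covariant 2-tensor field \<open>H\<close> is given by its component
  matrix \<open>H x $ i $ j = H\<^sub>x(\<partial>\<^sub>i, \<partial>\<^sub>j)\<close>.\<close>

definition bil :: "real^'n^'n \<Rightarrow> real^'n \<Rightarrow> real^'n \<Rightarrow> real" where
  "bil H u v = u \<bullet> (H *v v)"

definition frame :: "'n::finite \<Rightarrow> real^'n \<Rightarrow> real^'n" where
  "frame i = (\<lambda>_. axis i 1)"

definition dir_deriv :: "(real^'n \<Rightarrow> real^'n) \<Rightarrow> (real^'n \<Rightarrow> 'b::real_normed_vector) \<Rightarrow> real^'n \<Rightarrow> 'b" where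
  "dir_deriv Z f x = frechet_derivative f (at x) (Z x)"

definition lie_bracket :: "(real^'n \<Rightarrow> real^'n) \<Rightarrow> (real^'n \<Rightarrow> real^'n) \<Rightarrow> real^'n \<Rightarrow> real^'n" where
  "lie_bracket Y Z x = dir_deriv Y Z x - dir_deriv Z Y x"

text \<open>\<open>(\<pounds>\<^sub>Z H)(Y, W) = Z(H(Y, W)) - H([Z, Y], W) - H(Y, [Z, W])\<close> on the coordinate frame;
  see \<open>local_lie_deriv2_apply\<close> below for general \<open>Y\<close> and \<open>W\<close>.\<close>

definition local_lie_deriv2 ::
    "(real^'n \<Rightarrow> real^'n) \<Rightarrow> (real^'n \<Rightarrow> real^'n^'n) \<Rightarrow> real^'n \<Rightarrow> real^'n^'n" where
  "local_lie_deriv2 Z H x = (\<chi> i j.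
      dir_deriv Z (\<lambda>y. bil (H y) (frame i y) (frame j y)) x
      - bil (H x) (lie_bracket Z (frame i) x) (frame j x)
      - bil (H x) (frame i x) (lie_bracket Z (frame j) x))"

text \<open>\<open>christoffel G x k i j = \<Gamma>\<^sup>k\<^sub>i\<^sub>j\<close>.\<close>

definition christoffel :: "(real^'n \<Rightarrow> real^'n^'n) \<Rightarrow> real^'n \<Rightarrow> 'n \<Rightarrow> 'n \<Rightarrow> 'n \<Rightarrow> real" where
  "christoffel G x k i j = (\<Sum>m\<in>UNIV. matrix_inv (G x) $ k $ m *
      (dir_deriv (frame i) (\<lambda>y. G y $ m $ j) x
       + dir_deriv (frame j) (\<lambda>y. G y $ m $ i) x
       - dir_deriv (frame m) (\<lambda>y. G y $ i $ j) x)) / 2"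

definition christoffel_vec :: "(real^'n \<Rightarrow> real^'n^'n) \<Rightarrow> real^'n \<Rightarrow> real^'n \<Rightarrow> real^'n \<Rightarrow> real^'n" where
  "christoffel_vec G x u v = (\<chi> k. \<Sum>i\<in>UNIV. \<Sum>j\<in>UNIV. christoffel G x k i j * u $ i * v $ j)"

text \<open>The Levi-Civita connection \<open>\<nabla>\<^sub>Y Z\<close> of \<open>G\<close>; it is torsion free and metric by
  \<open>cov_deriv_torsion_free\<close> and \<open>cov_deriv_metric\<close> below.\<close>

definition cov_deriv ::
    "(real^'n \<Rightarrow> real^'n^'n) \<Rightarrow> (real^'n \<Rightarrow> real^'n) \<Rightarrow> (real^'n \<Rightarrow> real^'n) \<Rightarrow> real^'n \<Rightarrow> real^'n" where
  "cov_deriv G Y Z x = dir_deriv Y Z x + christoffel_vec G x (Y x) (Z x)"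

definition curvature ::
    "(real^'n \<Rightarrow> real^'n^'n) \<Rightarrow> (real^'n \<Rightarrow> real^'n) \<Rightarrow> (real^'n \<Rightarrow> real^'n) \<Rightarrow> (real^'n \<Rightarrow> real^'n)
      \<Rightarrow> real^'n \<Rightarrow> real^'n" where
  "curvature G Y Z W x =
     cov_deriv G Y (cov_deriv G Z W) x - cov_deriv G Z (cov_deriv G Y W) x
     - cov_deriv G (lie_bracket Y Z) W x"

text \<open>\<open>S(Z, W)\<close> is the trace of \<open>Y \<mapsto> R(Y, Z) W\<close>.\<close>

definition local_ricci :: "(real^'n \<Rightarrow> real^'n^'n) \<Rightarrow> real^'n \<Rightarrow> real^'n^'n" where
  "local_ricci G x = (\<chi> j k. \<Sum>i\<in>UNIV. curvature G (frame i) (frame j) (frame k) x $ i)"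

definition local_scalar :: "(real^'n \<Rightarrow> real^'n^'n) \<Rightarrow> real^'n \<Rightarrow> real" where
  "local_scalar G x = (\<Sum>i\<in>UNIV. \<Sum>j\<in>UNIV. matrix_inv (G x) $ i $ j * local_ricci G x $ i $ j)"

lemma bil_expand: "bil H u v = (\<Sum>i\<in>UNIV. \<Sum>j\<in>UNIV. u $ i * H $ i $ j * v $ j)"
  by (simp add: bil_def inner_vec_def matrix_vector_mult_def sum_distrib_left mult.assoc)

lemma bil_frame: "bil H (frame i x) (frame j y) = H $ i $ j"
  by (simp add: bil_def frame_def inner_axis' matrix_vector_mult_basis column_def)

lemma bilinear_mult_vec: "bounded_bilinear (\<lambda>(H::real^'n^'n) v. H *v v)"
  unfolding bilinear_conv_bounded_bilinear[symmetric] bilinear_def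
  by (auto intro!: linearI simp: matrix_vector_mult_add_rdistrib matrix_vector_right_distrib
        scaleR_matrix_vector_assoc matrix_vector_mult_scaleR)

lemma bil_has_derivative:
  assumes "(H has_derivative H') (at x)" "(Y has_derivative Y') (at x)" "(Z has_derivative Z') (at x)"
  shows "((\<lambda>y. bil (H y) (Y y) (Z y)) has_derivative
          (\<lambda>v. bil (H' v) (Y x) (Z x) + bil (H x) (Y' v) (Z x) + bil (H x) (Y x) (Z' v))) (at x)"
  unfolding bil_def
  by (rule has_derivative_eq_rhs,
      rule has_derivative_inner[OF assms(2) bounded_bilinear.FDERIV[OF bilinear_mult_vec assms(1,3)]])
     (auto simp: inner_add_right)

lemma dir_deriv_bil:
  assumes "H differentiable (at x)" "Y differentiable (at x)" "Z differentiable (at x)"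
  shows "dir_deriv V (\<lambda>y. bil (H y) (Y y) (Z y)) x =
     bil (dir_deriv V H x) (Y x) (Z x) + bil (H x) (dir_deriv V Y x) (Z x)
     + bil (H x) (Y x) (dir_deriv V Z x)"
  unfolding dir_deriv_def
    frechet_derivative_at[OF bil_has_derivative[OF assms[unfolded frechet_derivative_works]], symmetric] ..

lemma dir_deriv_frame: "dir_deriv V (frame i) x = 0"
  unfolding dir_deriv_def frame_def by simp

lemma dir_deriv_component:
  fixes H :: "real^'n::finite \<Rightarrow> real^'n^'n"
  assumes "H differentiable (at x)"
  shows "dir_deriv V (\<lambda>y. H y $ i $ j) x = dir_deriv V H x $ i $ j"
proof -
  have d: "(frame k) differentiable (at x)" for k :: 'n unfolding frame_def by simp
  show ?thesis
    using dir_deriv_bil[OF assms d d, of V i j] unfolding bil_frame dir_deriv_frame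
    by (simp add: bil_def)
qed

lemma frame_expand: "(\<Sum>i\<in>UNIV. u $ i *\<^sub>R frame i x) = u"
  using basis_expansion[of u] by (simp add: frame_def scalar_mult_eq_scaleR)

lemma local_lie_deriv2_apply:
  fixes H :: "real^'n::finite \<Rightarrow> real^'n^'n"
  assumes "H differentiable (at x)" "Y differentiable (at x)" "W differentiable (at x)"
    and "Z differentiable (at x)"
  shows "bil (local_lie_deriv2 Z H x) (Y x) (W x) =
     dir_deriv Z (\<lambda>y. bil (H y) (Y y) (W y)) x
     - bil (H x) (lie_bracket Z Y x) (W x) - bil (H x) (Y x) (lie_bracket Z W x)"
proof -
  have d: "(frame k) differentiable (at x)" for k :: 'n unfolding frame_def by simp
  define L where "L = frechet_derivative Z (at x)"
  have lin: "linear L" unfolding L_def using assms(4) by (rule linear_frechet_derivative)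
  have br: "lie_bracket Z (frame i) x = - L (frame i x)" for i
    by (simp add: lie_bracket_def dir_deriv_frame) (simp add: L_def dir_deriv_def)
  have brY: "lie_bracket Z Y x = dir_deriv Z Y x - L (Y x)" for Y
    by (simp add: lie_bracket_def L_def dir_deriv_def)
  have e: "local_lie_deriv2 Z H x $ i $ j = bil (dir_deriv Z H x) (frame i x) (frame j x)
      + bil (H x) (L (frame i x)) (frame j x) + bil (H x) (frame i x) (L (frame j x))" for i j
    unfolding local_lie_deriv2_def
    by (simp add: dir_deriv_bil[OF assms(1) d d] dir_deriv_frame br)
       (simp add: bil_def vec.neg)
  have LL: "L u = (\<Sum>i\<in>UNIV. u $ i *\<^sub>R L (frame i x))" for u
    by (subst frame_expand[of u x, symmetric]) (simp add: linear_sum[OF lin] linear_cmul[OF lin])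
  have s1: "(\<Sum>i\<in>UNIV. u $ i * bil K (F i) v) = bil K (\<Sum>i\<in>UNIV. u $ i *\<^sub>R F i) v" for u v :: "real^'n" and K F
    by (simp add: bil_def inner_sum_left)
  have s2: "(\<Sum>i\<in>UNIV. v $ i * bil K u (F i)) = bil K u (\<Sum>i\<in>UNIV. v $ i *\<^sub>R F i)" for u v :: "real^'n" and K F
    by (simp add: bil_def inner_sum_right matrix_vector_mult_scaleR vec.sum)
  have "bil (local_lie_deriv2 Z H x) u v =
     bil (dir_deriv Z H x) u v + bil (H x) (L u) v + bil (H x) u (L v)" for u v
  proof -
    have "bil (local_lie_deriv2 Z H x) u v = 
       (\<Sum>i\<in>UNIV. u $ i * (\<Sum>j\<in>UNIV. v $ j * bil (dir_deriv Z H x) (frame i x) (frame j x)))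
       + (\<Sum>i\<in>UNIV. u $ i * (\<Sum>j\<in>UNIV. v $ j * bil (H x) (L (frame i x)) (frame j x)))
       + (\<Sum>i\<in>UNIV. u $ i * (\<Sum>j\<in>UNIV. v $ j * bil (H x) (frame i x) (L (frame j x))))"
      unfolding bil_expand[of "local_lie_deriv2 Z H x"] e
      by (simp add: sum.distrib[symmetric] algebra_simps sum_distrib_left)
    then show ?thesis by (simp add: s1 s2 frame_expand LL[symmetric])
  qed
  then show ?thesis
    by (simp add: dir_deriv_bil[OF assms(1,2,3)] brY)
       (simp add: bil_def algebra_simps inner_diff_left inner_diff_right matrix_vector_mult_diff_distrib)
qed

text \<open>The two identities that characterise the Levi-Civita connection.\<close>

lemma cov_deriv_torsion_free:
  assumes "open S" "x \<in> S" "\<And>y. y \<in> S \<Longrightarrow> transpose (G y) = G y" "G differentiable (at x)"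
  shows "cov_deriv G Y Z x - cov_deriv G Z Y x = lie_bracket Y Z x"
    and "transpose (dir_deriv V G x) = dir_deriv V G x"
proof -
  have sym: "G y $ i $ j = G y $ j $ i" if "y \<in> S" for y i j
    using assms(3)[OF that] by (metis transpose_def vec_lambda_beta)
  have D: "dir_deriv V (\<lambda>y. G y $ i $ j) x = dir_deriv V (\<lambda>y. G y $ j $ i) x" for V i j
  proof -
    have "((\<lambda>y. G y $ i $ j) has_derivative f) (at x) \<longleftrightarrow> ((\<lambda>y. G y $ j $ i) has_derivative f) (at x)" for f
      using has_derivative_transform_within_open[OF _ assms(1,2)] sym by (metis (no_types, lifting))
    then show ?thesis by (simp add: dir_deriv_def frechet_derivative_def)
  qed
  then have "christoffel G x k i j = christoffel G x k j i" for k i j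
    by (simp add: christoffel_def add.commute)
  then have c: "christoffel G x k i j * u $ i * v $ j = christoffel G x k j i * v $ j * u $ i" for k i j u v
    by (simp add: mult_ac)
  have "christoffel_vec G x u v = christoffel_vec G x v u" for u v
  proof -
    have "christoffel_vec G x u v $ k = christoffel_vec G x v u $ k" for k
    proof -
      have "christoffel_vec G x u v $ k =
          (\<Sum>i\<in>UNIV. \<Sum>j\<in>UNIV. christoffel G x k j i * v $ j * u $ i)"
        unfolding christoffel_vec_def vec_lambda_beta
        by (intro sum.cong refl c)
      also have "\<dots> = christoffel_vec G x v u $ k"
        unfolding christoffel_vec_def vec_lambda_beta by (rule sum.swap)
      finally show ?thesis .
    qed
    then show ?thesis by (simp add: vec_eq_iff)
  qed
  then show "cov_deriv G Y Z x - cov_deriv G Z Y x = lie_bracket Y Z x"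
    by (simp add: cov_deriv_def lie_bracket_def)
  show "transpose (dir_deriv V G x) = dir_deriv V G x"
    using D[of V, unfolded dir_deriv_component[OF assms(4)]]
    unfolding transpose_def vec_eq_iff vec_lambda_beta by blast
qed

lemma cov_deriv_metric:
  fixes G :: "real^'n::finite \<Rightarrow> real^'n^'n"
  assumes "open S" "x \<in> S" "\<And>y. y \<in> S \<Longrightarrow> transpose (G y) = G y" "invertible (G x)"
    and "G differentiable (at x)" "Y differentiable (at x)" "Z differentiable (at x)"
  shows "dir_deriv V (\<lambda>y. bil (G y) (Y y) (Z y)) x =
     bil (G x) (cov_deriv G V Y x) (Z x) + bil (G x) (Y x) (cov_deriv G V Z x)"
proof -
  define D where "D = frechet_derivative G (at x)"
  have lin: "linear D" unfolding D_def using assms(5) by (rule linear_frechet_derivative)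
  have dD: "dir_deriv V G x = D (V x)" for V by (simp add: dir_deriv_def D_def)
  have c: "dir_deriv V (\<lambda>y. G y $ i $ j) x = D (V x) $ i $ j" for V i j
    by (simp add: dir_deriv_component[OF assms(5)] dD)
  have bsym: "bil K u v = bil K v u" if "transpose K = K" for K :: "real^'n^'n" and u v
    using that unfolding bil_def by (metis dot_lmul_matrix inner_commute transpose_matrix_vector)
  have symD: "bil (D w) u v = bil (D w) v u" for u v w
    using bsym[OF cov_deriv_torsion_free(2)[OF assms(1,2,3,5), of "\<lambda>_. w"]] by (simp add: dD)
  have symG: "bil (G x) u v = bil (G x) v u" for u v
    using bsym assms(2,3) by blast
  define F where "F u v = (\<chi> m. (bil (D u) (frame m x) v + bil (D v) (frame m x) u
       - bil (D (frame m x)) u v) / 2)" for u v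
  have s1: "(\<Sum>i\<in>UNIV. u $ i * bil K (E i) v) = bil K (\<Sum>i\<in>UNIV. u $ i *\<^sub>R E i) v" for u v :: "real^'n" and K E
    by (simp add: bil_def inner_sum_left)
  have s2: "(\<Sum>i\<in>UNIV. v $ i * bil K u (E i)) = bil K u (\<Sum>i\<in>UNIV. v $ i *\<^sub>R E i)" for u v :: "real^'n" and K E
    by (simp add: bil_def inner_sum_right matrix_vector_mult_scaleR vec.sum)
  have s3: "(\<Sum>i\<in>UNIV. w $ i * bil (D (E i)) u v) = bil (D (\<Sum>i\<in>UNIV. w $ i *\<^sub>R E i)) u v" for u v w :: "real^'n" and E
  proof -
    have "linear (\<lambda>w. bil (D w) u v)"
      using linear_compose[OF lin, of "\<lambda>K. bil K u v"]
      by (auto intro!: linearI simp: o_def bil_def linear_add[OF lin] linear_cmul[OF lin]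
            inner_add_right matrix_vector_mult_add_rdistrib scaleR_matrix_vector_assoc[symmetric])
    then show ?thesis by (simp add: linear_sum[where f = "\<lambda>w. bil (D w) u v"]
          linear_cmul[where f = "\<lambda>w. bil (D w) u v"])
  qed
  have "christoffel_vec G x u v = matrix_inv (G x) *v F u v" for u v
  proof -
    have F: "F u v $ m = (\<Sum>i\<in>UNIV. u $ i * (\<Sum>j\<in>UNIV. v $ j * (bil (D (frame i x)) (frame m x) (frame j x)
         + bil (D (frame j x)) (frame m x) (frame i x) - bil (D (frame m x)) (frame i x) (frame j x)))) / 2" for m
    proof -
      have "(\<Sum>i\<in>UNIV. u $ i * (\<Sum>j\<in>UNIV. v $ j * (bil (D (frame i x)) (frame m x) (frame j x)
         + bil (D (frame j x)) (frame m x) (frame i x) - bil (D (frame m x)) (frame i x) (frame j x))))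
       = (\<Sum>i\<in>UNIV. u $ i * (\<Sum>j\<in>UNIV. v $ j * bil (D (frame i x)) (frame m x) (frame j x)))
       + (\<Sum>i\<in>UNIV. u $ i * (\<Sum>j\<in>UNIV. v $ j * bil (D (frame j x)) (frame m x) (frame i x)))
       - (\<Sum>i\<in>UNIV. u $ i * (\<Sum>j\<in>UNIV. v $ j * bil (D (frame m x)) (frame i x) (frame j x)))"
        by (simp add: sum.distrib sum_subtractf ring_distribs)
      then show ?thesis by (simp add: s1 s2 s3 frame_expand F_def)
    qed
    show ?thesis
      unfolding christoffel_vec_def christoffel_def c bil_frame matrix_vector_mult_def vec_eq_iff vec_lambda_beta F
    proof (intro allI)
      fix k
      let ?t = "\<lambda>m i j. D (frame i x) $ m $ j + D (frame j x) $ m $ i - D (frame m x) $ i $ j"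
      have "(\<Sum>i\<in>UNIV. \<Sum>j\<in>UNIV. (\<Sum>m\<in>UNIV. matrix_inv (G x) $ k $ m * ?t m i j) / 2 * u $ i * v $ j)
        = (\<Sum>i\<in>UNIV. \<Sum>j\<in>UNIV. \<Sum>m\<in>UNIV. matrix_inv (G x) $ k $ m * (u $ i * (v $ j * ?t m i j)) / 2)"
        by (simp add: sum_divide_distrib sum_distrib_left sum_distrib_right mult_ac)
      also have "\<dots> = (\<Sum>i\<in>UNIV. \<Sum>m\<in>UNIV. \<Sum>j\<in>UNIV. matrix_inv (G x) $ k $ m * (u $ i * (v $ j * ?t m i j)) / 2)"
        by (rule sum.cong[OF refl], rule sum.swap)
      also have "\<dots> = (\<Sum>m\<in>UNIV. \<Sum>i\<in>UNIV. \<Sum>j\<in>UNIV. matrix_inv (G x) $ k $ m * (u $ i * (v $ j * ?t m i j)) / 2)"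
        by (rule sum.swap)
      finally show "(\<Sum>i\<in>UNIV. \<Sum>j\<in>UNIV. (\<Sum>m\<in>UNIV. matrix_inv (G x) $ k $ m * ?t m i j) / 2 * u $ i * v $ j)
        = (\<Sum>m\<in>UNIV. matrix_inv (G x) $ k $ m * ((\<Sum>i\<in>UNIV. u $ i * (\<Sum>j\<in>UNIV. v $ j * ?t m i j)) / 2))"
        by (simp add: sum_divide_distrib sum_distrib_left)
    qed
  qed
  moreover have "G x ** matrix_inv (G x) = mat 1"
    using someI_ex[OF assms(4)[unfolded invertible_def]] unfolding matrix_inv_def by blast
  ultimately have "G x *v christoffel_vec G x u v = F u v" for u v
    by (simp add: matrix_vector_mul_assoc)
  then have "bil (G x) w (christoffel_vec G x u v) = w \<bullet> F u v" for u v w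
    by (simp add: bil_def)
  moreover have "w \<bullet> F u v = (bil (D u) w v + bil (D v) w u - bil (D w) u v) / 2" for u v w
  proof -
    have "w \<bullet> F u v = ((\<Sum>m\<in>UNIV. w $ m * bil (D u) (frame m x) v) + (\<Sum>m\<in>UNIV. w $ m * bil (D v) (frame m x) u)
        - (\<Sum>m\<in>UNIV. w $ m * bil (D (frame m x)) u v)) / 2"
      by (simp add: inner_vec_def F_def sum.distrib sum_subtractf sum_divide_distrib[symmetric] ring_distribs)
    then show ?thesis by (simp add: s1 s3 frame_expand)
  qed
  ultimately have G: "bil (G x) w (christoffel_vec G x u v)
      = (bil (D u) w v + bil (D v) w u - bil (D w) u v) / 2" for u v w
    by simp
  have add: "bil (G x) u (v + w) = bil (G x) u v + bil (G x) u w" for u v w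
    by (simp add: bil_def inner_add_right matrix_vector_right_distrib)
  show ?thesis
    unfolding dir_deriv_bil[OF assms(5,6,7)] cov_deriv_def symG[of "_ + _"] add G dD
    using symD symG[of "dir_deriv V Y x"] by (simp add: field_simps)
qed

section \<open>Lorentzian manifolds\<close>

text \<open>A chart is a pair of its domain and its coordinate map, whose values outside the domain are
  irrelevant. The dimension is \<open>CARD('n)\<close>.\<close>

type_synonym ('a, 'n) chart = "'a set \<times> ('a \<Rightarrow> real^'n)"

definition chart_on :: "'a topology \<Rightarrow> ('a, 'n::finite) chart \<Rightarrow> bool" where
  "chart_on X c \<longleftrightarrow> openin X (fst c) \<and> open (snd c ` fst c) \<and>
     homeomorphic_map (subtopology X (fst c)) (top_of_set (snd c ` fst c)) (snd c)"

definition chart_inv :: "('a, 'n::finite) chart \<Rightarrow> real^'n \<Rightarrow> 'a" where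
  "chart_inv c = inv_into (fst c) (snd c)"

definition transition :: "('a, 'n::finite) chart \<Rightarrow> ('a, 'n) chart \<Rightarrow> real^'n \<Rightarrow> real^'n" where
  "transition c d = snd d \<circ> chart_inv c"

definition jacobian :: "('a, 'n::finite) chart \<Rightarrow> ('a, 'n) chart \<Rightarrow> 'a \<Rightarrow> real^'n^'n" where
  "jacobian c d q = matrix (frechet_derivative (transition c d) (at (snd c q)))"

definition smooth_manifold :: "'a topology \<Rightarrow> ('a, 'n::finite) chart set \<Rightarrow> bool" where
  "smooth_manifold X A \<longleftrightarrow>
     Hausdorff_space X \<and> second_countable X \<and>
     (\<forall>c\<in>A. chart_on X c) \<and> topspace X = (\<Union>c\<in>A. fst c) \<and>
     (\<forall>c\<in>A. \<forall>d\<in>A. smooth_on (snd c ` (fst c \<inter> fst d)) (transition c d))"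

definition in_chart :: "('a, 'n::finite) chart \<Rightarrow> ('a \<Rightarrow> 'b) \<Rightarrow> real^'n \<Rightarrow> 'b" where
  "in_chart c f = f \<circ> chart_inv c"

definition smooth_fun :: "('a, 'n::finite) chart set \<Rightarrow> ('a \<Rightarrow> real) \<Rightarrow> bool" where
  "smooth_fun A f \<longleftrightarrow> (\<forall>c\<in>A. smooth_on (snd c ` fst c) (in_chart c f))"

text \<open>Tensor fields are families of components, one for each chart, related by the tensor
  transformation law; \<open>Z c q\<close> is the component vector of \<open>Z\<close> at \<open>q\<close> in the chart \<open>c\<close>, and \<open>h c q\<close> is
  the component matrix of \<open>h\<close>. Only the values for \<open>c\<close> in the atlas and \<open>q\<close> in the domain of \<open>c\<close>
  matter.\<close>

type_synonym ('a, 'n) vfield = "('a, 'n) chart \<Rightarrow> 'a \<Rightarrow> real^'n"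
type_synonym ('a, 'n) tensor2 = "('a, 'n) chart \<Rightarrow> 'a \<Rightarrow> real^'n^'n"

definition smooth_vector_field :: "('a, 'n::finite) chart set \<Rightarrow> ('a, 'n) vfield \<Rightarrow> bool" where
  "smooth_vector_field A Z \<longleftrightarrow>
     (\<forall>c\<in>A. smooth_on (snd c ` fst c) (in_chart c (Z c))) \<and>
     (\<forall>c\<in>A. \<forall>d\<in>A. \<forall>q\<in>fst c \<inter> fst d. Z d q = jacobian c d q *v Z c q)"

definition smooth_tensor2 :: "('a, 'n::finite) chart set \<Rightarrow> ('a, 'n) tensor2 \<Rightarrow> bool" where
  "smooth_tensor2 A h \<longleftrightarrow>
     (\<forall>c\<in>A. smooth_on (snd c ` fst c) (in_chart c (h c))) \<and>
     (\<forall>c\<in>A. \<forall>d\<in>A. \<forall>q\<in>fst c \<inter> fst d.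
        h c q = transpose (jacobian c d q) ** h d q ** jacobian c d q)"

text \<open>Signature \<open>(-,+,\<dots>,+)\<close>: the columns of \<open>P\<close> form an orthonormal basis with exactly one
  timelike vector.\<close>

definition lorentzian_form :: "real^'n^'n \<Rightarrow> bool" where
  "lorentzian_form H \<longleftrightarrow> transpose H = H \<and>
     (\<exists>(P::real^'n^'n) i0. invertible P \<and>
        transpose P ** H ** P = (\<chi> i j. if i \<noteq> j then 0 else if i = i0 then -1 else 1))"

definition lorentzian_manifold ::
    "'a topology \<Rightarrow> ('a, 'n::finite) chart set \<Rightarrow> ('a, 'n) tensor2 \<Rightarrow> bool" where
  "lorentzian_manifold X A g \<longleftrightarrow>
     smooth_manifold X A \<and> smooth_tensor2 A g \<and> (\<forall>c\<in>A. \<forall>q\<in>fst c. lorentzian_form (g c q))"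

text \<open>The components of \<open>\<pounds>\<^sub>Z h\<close>, of the Ricci tensor \<open>S\<close> and of the scalar curvature \<open>R\<close> in the
  chart \<open>c\<close>. As these are tensor fields, the value of \<open>scalar_curv g c q\<close> does not depend on \<open>c\<close>.\<close>

definition lie_deriv2 :: "('a, 'n::finite) vfield \<Rightarrow> ('a, 'n) tensor2 \<Rightarrow> ('a, 'n) tensor2" where
  "lie_deriv2 Z h c q = local_lie_deriv2 (in_chart c (Z c)) (in_chart c (h c)) (snd c q)"

definition lie_deriv0 :: "('a, 'n::finite) vfield \<Rightarrow> ('a \<Rightarrow> real) \<Rightarrow> ('a, 'n) chart \<Rightarrow> 'a \<Rightarrow> real" where
  "lie_deriv0 Z f c q = dir_deriv (in_chart c (Z c)) (in_chart c f) (snd c q)"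

definition ricci :: "('a, 'n::finite) tensor2 \<Rightarrow> ('a, 'n) tensor2" where
  "ricci g c q = local_ricci (in_chart c (g c)) (snd c q)"

definition scalar_curv :: "('a, 'n::finite) tensor2 \<Rightarrow> ('a, 'n) chart \<Rightarrow> 'a \<Rightarrow> real" where
  "scalar_curv g c q = local_scalar (in_chart c (g c)) (snd c q)"

definition flat :: "('a, 'n::finite) tensor2 \<Rightarrow> ('a, 'n) vfield \<Rightarrow> ('a, 'n) chart \<Rightarrow> 'a \<Rightarrow> real^'n" where
  "flat g Z c q = g c q *v Z c q"

definition covector_tensor :: "real^'n \<Rightarrow> real^'n \<Rightarrow> real^'n^'n" where
  "covector_tensor a b = (\<chi> i j. a $ i * b $ j)"

section \<open>Curves\<close>

definition smooth_curve ::
    "'a topology \<Rightarrow> ('a, 'n::finite) chart set \<Rightarrow> real set \<Rightarrow> (real \<Rightarrow> 'a) \<Rightarrow> bool" where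
  "smooth_curve X A I \<gamma> \<longleftrightarrow>
     open I \<and> is_interval I \<and> continuous_map (top_of_set I) X \<gamma> \<and>
     (\<forall>c\<in>A. smooth_on {t\<in>I. \<gamma> t \<in> fst c} (snd c \<circ> \<gamma>))"

definition velocity :: "('a, 'n::finite) chart \<Rightarrow> (real \<Rightarrow> 'a) \<Rightarrow> real \<Rightarrow> real^'n" where
  "velocity c \<gamma> t = vector_derivative (snd c \<circ> \<gamma>) (at t)"

definition integral_curve ::
    "'a topology \<Rightarrow> ('a, 'n::finite) chart set \<Rightarrow> ('a, 'n) vfield \<Rightarrow> real set \<Rightarrow> (real \<Rightarrow> 'a) \<Rightarrow> bool" where
  "integral_curve X A Z I \<gamma> \<longleftrightarrow> smooth_curve X A I \<gamma> \<and>
     (\<forall>c\<in>A. \<forall>t\<in>I. \<gamma> t \<in> fst c \<longrightarrow> velocity c \<gamma> t = Z c (\<gamma> t))"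

text \<open>The covariant derivative of the velocity of \<open>\<gamma>\<close> along \<open>\<gamma>\<close>.\<close>

definition acceleration ::
    "('a, 'n::finite) tensor2 \<Rightarrow> ('a, 'n) chart \<Rightarrow> (real \<Rightarrow> 'a) \<Rightarrow> real \<Rightarrow> real^'n" where
  "acceleration g c \<gamma> t = vector_derivative (velocity c \<gamma>) (at t)
     + christoffel_vec (in_chart c (g c)) (snd c (\<gamma> t)) (velocity c \<gamma> t) (velocity c \<gamma> t)"

definition geodesic ::
    "'a topology \<Rightarrow> ('a, 'n::finite) chart set \<Rightarrow> ('a, 'n) tensor2 \<Rightarrow> real set \<Rightarrow> (real \<Rightarrow> 'a) \<Rightarrow> bool" where
  "geodesic X A g I \<gamma> \<longleftrightarrow> smooth_curve X A I \<gamma> \<and>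
     (\<forall>c\<in>A. \<forall>t\<in>I. \<gamma> t \<in> fst c \<longrightarrow> acceleration g c \<gamma> t = 0)"

section \<open>Perfect fluids, stationary spacetimes and Yamabe solitons\<close>

definition unit_timelike ::
    "('a, 'n::finite) chart set \<Rightarrow> ('a, 'n) tensor2 \<Rightarrow> ('a, 'n) vfield \<Rightarrow> bool" where
  "unit_timelike A g Z \<longleftrightarrow> (\<forall>c\<in>A. \<forall>q\<in>fst c. bil (g c q) (Z c q) (Z c q) = -1)"

text \<open>``Non-vanishing'' and ``not simultaneously zero'' are read as ``not identically zero'', which is
  weaker than demanding this at every point.\<close>

definition perfect_fluid ::
    "'a topology \<Rightarrow> ('a, 'n::finite) chart set \<Rightarrow> ('a, 'n) tensor2 \<Rightarrow> ('a, 'n) vfield \<Rightarrow> bool" where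
  "perfect_fluid X A g \<rho> \<longleftrightarrow>
     lorentzian_manifold X A g \<and> smooth_vector_field A \<rho> \<and> unit_timelike A g \<rho> \<and>
     (\<exists>c\<in>A. \<exists>q\<in>fst c. ricci g c q \<noteq> 0) \<and>
     (\<exists>\<alpha> \<beta>. smooth_fun A \<alpha> \<and> smooth_fun A \<beta> \<and>
        (\<exists>q\<in>topspace X. \<alpha> q \<noteq> 0 \<or> \<beta> q \<noteq> 0) \<and>
        (\<forall>c\<in>A. \<forall>q\<in>fst c. ricci g c q =
           \<alpha> q *\<^sub>R g c q + \<beta> q *\<^sub>R covector_tensor (flat g \<rho> c q) (flat g \<rho> c q)))"

definition energy_momentum ::
    "('a, 'n::finite) tensor2 \<Rightarrow> ('a, 'n) vfield \<Rightarrow> ('a \<Rightarrow> real) \<Rightarrow> ('a \<Rightarrow> real) \<Rightarrow> ('a, 'n) tensor2" where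
  "energy_momentum g \<rho> \<sigma> p c q =
     (p q + \<sigma> q) *\<^sub>R covector_tensor (flat g \<rho> c q) (flat g \<rho> c q) + p q *\<^sub>R g c q"

definition einstein_field_eq ::
    "('a, 'n::finite) chart set \<Rightarrow> ('a, 'n) tensor2 \<Rightarrow> real \<Rightarrow> ('a, 'n) tensor2 \<Rightarrow> bool" where
  "einstein_field_eq A g \<kappa> T \<longleftrightarrow>
     (\<forall>c\<in>A. \<forall>q\<in>fst c. ricci g c q - (scalar_curv g c q / 2) *\<^sub>R g c q = \<kappa> *\<^sub>R T c q)"

definition almost_yamabe_soliton ::
    "'a topology \<Rightarrow> ('a, 'n::finite) chart set \<Rightarrow> ('a, 'n) tensor2 \<Rightarrow> ('a, 'n) vfield
      \<Rightarrow> ('a \<Rightarrow> real) \<Rightarrow> ('a \<Rightarrow> real) \<Rightarrow> bool" where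
  "almost_yamabe_soliton X A g Z k lam \<longleftrightarrow>
     smooth_vector_field A Z \<and> smooth_fun A k \<and> (\<forall>q\<in>topspace X. k q \<noteq> 0) \<and> smooth_fun A lam \<and>
     (\<forall>c\<in>A. \<forall>q\<in>fst c.
        (k q / 2) *\<^sub>R lie_deriv2 Z g c q = (scalar_curv g c q - lam q) *\<^sub>R g c q)"

definition killing_field :: "('a, 'n::finite) chart set \<Rightarrow> ('a, 'n) tensor2 \<Rightarrow> ('a, 'n) vfield \<Rightarrow> bool" where
  "killing_field A g Z \<longleftrightarrow>
     smooth_vector_field A Z \<and> (\<forall>c\<in>A. \<forall>q\<in>fst c. lie_deriv2 Z g c q = 0)"

definition stationary :: "('a, 'n::finite) chart set \<Rightarrow> ('a, 'n) tensor2 \<Rightarrow> bool" where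
  "stationary A g \<longleftrightarrow>
     (\<exists>Z. killing_field A g Z \<and> (\<forall>c\<in>A. \<forall>q\<in>fst c. bil (g c q) (Z c q) (Z c q) < 0))"

end

theory Submission
  imports Defs
begin

text \<open>Evaluating the soliton equation on \<open>(\<rho>, \<rho>)\<close>, where \<open>\<pounds>\<^sub>\<rho> g\<close> vanishes because \<open>\<rho>\<close> is a unit
  field, forces \<open>R = \<lambda>\<close>, so \<open>\<rho>\<close> is Killing, and a Killing field of constant length is geodesic. The bracket with a
  Killing field \<open>Z\<close> is a derivation of \<open>\<nabla>\<close>: the defect \<open>D(X, Y)\<close> is symmetric because \<open>\<nabla>\<close> is torsion free,
  and \<open>g(D(X, Y), W)\<close> is skew in \<open>Y, W\<close> because \<open>\<nabla>\<close> is metric. Hence \<open>Z\<close> also preserves the curvature and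
  its trace \<open>S = \<alpha> g + \<beta> C \<otimes> C\<close>. As \<open>g\<close> and \<open>C \<otimes> C\<close> are preserved and linearly independent, \<open>\<alpha>\<close> and
  \<open>\<beta>\<close> are constant along \<open>\<rho>\<close>, and the field equations express \<open>p\<close> and \<open>\<sigma>\<close> linearly in them.\<close>

section \<open>Calculus of smooth maps\<close>

text \<open>On an open set, agreement of two maps forces them to have the same derivatives at each
  point, so the statement passes through the recursion on \<open>k\<close>. It allows a derivative
  to be replaced by an explicit formula known only on \<open>S\<close>.\<close>

lemma Ck_on_cong:
  assumes "open S" "\<And>x. x \<in> S \<Longrightarrow> f x = g x"
  shows "Ck_on k S f = Ck_on k S g"
  using assms(2)
proof (induction k arbitrary: f g)
  case 0
  then show ?case by (simp cong: continuous_on_cong)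
next
  case (Suc k)
  have hd: "(f has_derivative f') (at x) \<longleftrightarrow> (g has_derivative f') (at x)" if "x \<in> S" for x f'
    using Suc.prems has_derivative_transform_within_open[OF _ assms(1) that] by (metis (no_types, lifting))
  have "Ck_on k S (\<lambda>x. frechet_derivative f (at x) v) = Ck_on k S (\<lambda>x. frechet_derivative g (at x) v)" for v
    by (rule Suc.IH) (simp add: frechet_derivative_def hd)
  moreover have "f differentiable (at x) \<longleftrightarrow> g differentiable (at x)" if "x \<in> S" for x
    using hd[OF that] by (simp add: differentiable_def)
  ultimately show ?case by simp
qed

lemma Ck_on_Suc_imp: "Ck_on (Suc k) S f \<Longrightarrow> Ck_on k S f"
proof (induction k arbitrary: f)
  case 0
  then show ?case
    by (auto intro!: continuous_at_imp_continuous_on differentiable_imp_continuous_within)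
qed auto

lemma Ck_on_const: "Ck_on k S (\<lambda>_. c)"
  by (induction k arbitrary: c) auto

lemma Ck_on_bounded_linear:
  assumes "bounded_linear h" "open S" "Ck_on k S f"
  shows "Ck_on k S (\<lambda>x. h (f x))"
  using assms(3)
proof (induction k arbitrary: f)
  case 0
  then show ?case using bounded_linear.continuous_on[OF assms(1)] by auto
next
  case (Suc k)
  then have d: "f differentiable (at x)" if "x \<in> S" for x using that by simp
  have hd: "((\<lambda>x. h (f x)) has_derivative (\<lambda>v. h (frechet_derivative f (at x) v))) (at x)" if "x \<in> S" for x
    using bounded_linear.has_derivative[OF assms(1)] d[OF that] by (simp add: frechet_derivative_works)
  \<comment> \<open>The formula for the derivative holds only on \<open>S\<close>, so it is
    substituted through \<open>Ck_on_cong\<close> and not by rewriting. The following closure lemmas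
    repeat this pattern.\<close>
  have "Ck_on k S (\<lambda>x. frechet_derivative (\<lambda>x. h (f x)) (at x) v)" for v
    by (rule Ck_on_cong[OF assms(2), THEN iffD1, rotated, OF Suc.IH[of "\<lambda>x. frechet_derivative f (at x) v"]])
       (use Suc.prems in \<open>simp_all add: frechet_derivative_at[OF hd, symmetric]\<close>)
  then show ?case using hd by (auto simp: differentiable_def)
qed

lemma Ck_on_add:
  assumes "open S" "Ck_on k S f" "Ck_on k S g"
  shows "Ck_on k S (\<lambda>x. f x + g x)"
  using assms(2,3)
proof (induction k arbitrary: f g)
  case 0
  then show ?case by (auto intro: continuous_on_add)
next
  case (Suc k)
  have hd: "((\<lambda>x. f x + g x) has_derivative
      (\<lambda>v. frechet_derivative f (at x) v + frechet_derivative g (at x) v)) (at x)" if "x \<in> S" for x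
    using Suc.prems that by (intro has_derivative_add) (simp_all add: frechet_derivative_works[symmetric])
  have "Ck_on k S (\<lambda>x. frechet_derivative (\<lambda>x. f x + g x) (at x) v)" for v
    by (rule Ck_on_cong[OF assms(1), THEN iffD1, rotated,
          OF Suc.IH[of "\<lambda>x. frechet_derivative f (at x) v" "\<lambda>x. frechet_derivative g (at x) v"]])
       (use Suc.prems in \<open>simp_all add: frechet_derivative_at[OF hd, symmetric]\<close>)
  then show ?case using hd by (auto simp: differentiable_def)
qed

text \<open>One Leibniz rule for all products: multiplication, scaling, inner product and
  matrix-vector product are instances. Both maps are generalised in the induction because each
  summand of the derivative pairs one map with the derivative of the other.\<close>

lemma Ck_on_bilinear:
  assumes "bounded_bilinear h" "open S" "Ck_on k S f" "Ck_on k S g"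
  shows "Ck_on k S (\<lambda>x. h (f x) (g x))"
  using assms(3,4)
proof (induction k arbitrary: f g)
  case 0
  then show ?case using bounded_bilinear.continuous_on[OF assms(1)] by auto
next
  case (Suc k)
  have hd: "((\<lambda>x. h (f x) (g x)) has_derivative
      (\<lambda>v. h (f x) (frechet_derivative g (at x) v) + h (frechet_derivative f (at x) v) (g x))) (at x)"
    if "x \<in> S" for x
    using Suc.prems that
    by (intro bounded_bilinear.FDERIV[OF assms(1)]) (simp_all add: frechet_derivative_works[symmetric])
  have "Ck_on k S (\<lambda>x. frechet_derivative (\<lambda>x. h (f x) (g x)) (at x) v)" for v
    by (rule Ck_on_cong[OF assms(2), THEN iffD1, rotated,
          OF Ck_on_add[OF assms(2) Suc.IH[of f "\<lambda>x. frechet_derivative g (at x) v"]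
             Suc.IH[of "\<lambda>x. frechet_derivative f (at x) v" g]]])
       (use Suc.prems in \<open>auto simp: frechet_derivative_at[OF hd, symmetric] intro: Ck_on_Suc_imp\<close>)
  then show ?case using hd by (auto simp: differentiable_def)
qed

text \<open>The derivative of 1/f is -(1/f) f' (1/f), so one order of regularity of 1/f follows from
  the previous order of 1/f and that of f'.\<close>

lemma Ck_on_inverse:
  fixes f :: "'a::real_normed_vector \<Rightarrow> real"
  assumes "open S" "\<And>x. x \<in> S \<Longrightarrow> f x \<noteq> 0" "Ck_on k S f"
  shows "Ck_on k S (\<lambda>x. inverse (f x))"
  using assms(3)
proof (induction k)
  case 0
  then show ?case using assms(2) by (auto intro: continuous_on_inverse)
next
  case (Suc k)
  note mult = Ck_on_bilinear[OF bounded_bilinear_mult assms(1)]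
  have hd: "((\<lambda>x. inverse (f x)) has_derivative
      (\<lambda>v. - (inverse (f x) * frechet_derivative f (at x) v * inverse (f x)))) (at x)" if "x \<in> S" for x
    using Suc.prems that assms(2)
    by (intro Deriv.has_derivative_inverse) (simp_all add: frechet_derivative_works[symmetric])
  have i: "Ck_on k S (\<lambda>x. inverse (f x))"
    using Suc.IH Ck_on_Suc_imp[OF Suc.prems] .
  have "Ck_on k S (\<lambda>x. - (inverse (f x) * frechet_derivative f (at x) v * inverse (f x)))" for v
    using Suc.prems by (auto intro!: Ck_on_bounded_linear[OF bounded_linear_minus[OF bounded_linear_ident] assms(1)]
        mult[OF mult[OF i] i])
  then have "Ck_on k S (\<lambda>x. frechet_derivative (\<lambda>x. inverse (f x)) (at x) v)" for v
    by (subst Ck_on_cong[OF assms(1), where g = "\<lambda>x. - (inverse (f x) * frechet_derivative f (at x) v * inverse (f x))"])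
       (simp_all add: frechet_derivative_at[OF hd, symmetric])
  then show ?case using hd by (auto simp: differentiable_def)
qed

section \<open>Closure properties of smooth maps\<close>

lemma smooth_on_imp_differentiable: "smooth_on S f \<Longrightarrow> x \<in> S \<Longrightarrow> f differentiable (at x)"
  unfolding smooth_on_def using Ck_on.simps(2) by metis

lemma smooth_on_imp_continuous_on: "smooth_on S f \<Longrightarrow> continuous_on S f"
  unfolding smooth_on_def using Ck_on.simps(1) by metis

lemma smooth_on_cong:
  "open S \<Longrightarrow> (\<And>x. x \<in> S \<Longrightarrow> f x = g x) \<Longrightarrow> smooth_on S f = smooth_on S g"
  unfolding smooth_on_def using Ck_on_cong by metis

lemma smooth_on_const: "smooth_on S (\<lambda>_. c)"
  by (simp add: smooth_on_def Ck_on_const)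

lemma smooth_on_bounded_linear:
  "bounded_linear h \<Longrightarrow> open S \<Longrightarrow> smooth_on S f \<Longrightarrow> smooth_on S (\<lambda>x. h (f x))"
  by (simp add: smooth_on_def Ck_on_bounded_linear)

lemma smooth_on_bilinear:
  "bounded_bilinear h \<Longrightarrow> open S \<Longrightarrow> smooth_on S f \<Longrightarrow> smooth_on S g \<Longrightarrow> smooth_on S (\<lambda>x. h (f x) (g x))"
  by (simp add: smooth_on_def Ck_on_bilinear)

lemma smooth_on_add:
  "open S \<Longrightarrow> smooth_on S f \<Longrightarrow> smooth_on S g \<Longrightarrow> smooth_on S (\<lambda>x. f x + g x)"
  by (simp add: smooth_on_def Ck_on_add)

lemma smooth_on_diff:
  "open S \<Longrightarrow> smooth_on S f \<Longrightarrow> smooth_on S g \<Longrightarrow> smooth_on S (\<lambda>x. f x - g x)"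
  using smooth_on_add[OF _ _ smooth_on_bounded_linear[OF bounded_linear_minus[OF bounded_linear_ident]], of S f g]
  by simp

lemma smooth_on_mult:
  fixes f g :: "'a::real_normed_vector \<Rightarrow> real"
  shows "open S \<Longrightarrow> smooth_on S f \<Longrightarrow> smooth_on S g \<Longrightarrow> smooth_on S (\<lambda>x. f x * g x)"
  by (rule smooth_on_bilinear[OF bounded_bilinear_mult])

lemma smooth_on_scaleR:
  "open S \<Longrightarrow> smooth_on S f \<Longrightarrow> smooth_on S g \<Longrightarrow> smooth_on S (\<lambda>x. f x *\<^sub>R g x)"
  by (rule smooth_on_bilinear[OF bounded_bilinear_scaleR])

lemma smooth_on_divide:
  fixes f g :: "'a::real_normed_vector \<Rightarrow> real"
  assumes "open S" "smooth_on S f" "smooth_on S g" "\<And>x. x \<in> S \<Longrightarrow> g x \<noteq> 0"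
  shows "smooth_on S (\<lambda>x. f x / g x)"
  unfolding divide_inverse
  by (rule smooth_on_mult) (use assms in \<open>auto simp: smooth_on_def intro!: Ck_on_inverse\<close>)

lemma smooth_on_sum:
  assumes "open S" "\<And>i. i \<in> I \<Longrightarrow> smooth_on S (f i)"
  shows "smooth_on S (\<lambda>x. \<Sum>i\<in>I. f i x)"
  using assms(2)
  by (induction I rule: infinite_finite_induct) (auto intro: smooth_on_const smooth_on_add[OF assms(1)])

lemma smooth_on_prod:
  fixes f :: "'i \<Rightarrow> 'a::real_normed_vector \<Rightarrow> real"
  assumes "open S" "\<And>i. i \<in> I \<Longrightarrow> smooth_on S (f i)"
  shows "smooth_on S (\<lambda>x. \<Prod>i\<in>I. f i x)"
  using assms(2)
  by (induction I rule: infinite_finite_induct) (auto intro: smooth_on_const smooth_on_mult[OF assms(1)])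

lemma smooth_on_nth:
  "open S \<Longrightarrow> smooth_on S f \<Longrightarrow> smooth_on S (\<lambda>x. f x $ i)"
  by (rule smooth_on_bounded_linear[OF bounded_linear_vec_nth])

lemma smooth_on_vec_lambda:
  fixes f :: "'n::finite \<Rightarrow> 'a::real_normed_vector \<Rightarrow> 'b::euclidean_space"
  assumes "open S" "\<And>i. smooth_on S (f i)"
  shows "smooth_on S (\<lambda>x. \<chi> i. f i x)"
proof -
  have "(\<chi> i. f i x) = (\<Sum>i\<in>UNIV. axis i (f i x))" for x
    by (simp add: vec_eq_iff axis_def)
  moreover have "bounded_linear (axis i :: 'b \<Rightarrow> 'b^'n)" for i
    unfolding linear_conv_bounded_linear[symmetric] by (intro linearI) (simp_all add: vec_eq_iff axis_def)
  ultimately show ?thesis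
    by (simp add: smooth_on_sum smooth_on_bounded_linear assms)
qed

lemma smooth_on_det:
  fixes H :: "'a::real_normed_vector \<Rightarrow> real^'n^'n"
  assumes "open S" "\<And>i j. smooth_on S (\<lambda>x. H x $ i $ j)"
  shows "smooth_on S (\<lambda>x. det (H x))"
  unfolding det_def
  by (intro smooth_on_sum smooth_on_mult smooth_on_const smooth_on_prod assms)

lemma matrix_inv_cancel:
  fixes H :: "real^'n^'n"
  assumes "invertible H"
  shows "H ** matrix_inv H = mat 1" "matrix_inv H ** H = mat 1"
  using someI_ex[OF assms[unfolded invertible_def]] unfolding matrix_inv_def by blast+

text \<open>By Cramer's rule an entry of the inverse is a quotient of two determinants, both
  polynomial in the entries of \<open>H x\<close>. This is what makes the Christoffel symbols
  smooth.\<close>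

lemma smooth_on_matrix_inv:
  fixes H :: "'a::real_normed_vector \<Rightarrow> real^'n^'n"
  assumes "open S" "smooth_on S H" "\<And>x. x \<in> S \<Longrightarrow> invertible (H x)"
  shows "smooth_on S (\<lambda>x. matrix_inv (H x) $ i $ j)"
proof -
  have e: "matrix_inv (H x) $ i $ j =
      det (\<chi> r c. if c = i then axis j 1 $ r else H x $ r $ c) / det (H x)" if "x \<in> S" for x
  proof -
    have "H x *v (matrix_inv (H x) *v axis j 1) = axis j 1"
      by (simp add: matrix_vector_mul_assoc matrix_inv_cancel assms(3) that)
    then have "matrix_inv (H x) *v axis j 1 =
        (\<chi> k. det (\<chi> r c. if c = k then axis j 1 $ r else H x $ r $ c) / det (H x))"
      using assms(3)[OF that] unfolding invertible_det_nz by (subst (asm) cramer)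
    then show ?thesis
      by (simp add: matrix_vector_mult_basis column_def vec_eq_iff)
  qed
  have c: "smooth_on S (\<lambda>x. if c = i then axis j 1 $ r else H x $ r $ c)" for r c
    by (cases "c = i") (auto intro!: smooth_on_const smooth_on_nth assms)
  have "smooth_on S (\<lambda>x. det (\<chi> r c. if c = i then axis j 1 $ r else H x $ r $ c) / det (H x))"
    using assms c
    by (intro smooth_on_divide smooth_on_det) (auto intro!: smooth_on_nth simp: invertible_det_nz)
  then show ?thesis
    by (simp add: e cong: smooth_on_cong[OF assms(1)])
qed

lemma smooth_on_frechet_derivative:
  "smooth_on S f \<Longrightarrow> smooth_on S (\<lambda>x. frechet_derivative f (at x) v)"
  unfolding smooth_on_def using Ck_on.simps(2) by metis

section \<open>Symmetry of second derivatives\<close>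

text \<open>The mean value theorem is applied twice: first along \<open>v\<close> to the increment
  of \<open>f\<close> in direction \<open>t *\<^sub>R w\<close>, then along \<open>w\<close> to the
  derivative of \<open>f\<close> in direction \<open>v\<close>.\<close>

lemma second_difference_mean_value:
  fixes f :: "'a::real_normed_vector \<Rightarrow> real"
  assumes f: "smooth_on S f" and "t > 0"
    and S: "\<And>s r. 0 \<le> s \<Longrightarrow> s \<le> t \<Longrightarrow> 0 \<le> r \<Longrightarrow> r \<le> t \<Longrightarrow> x + s *\<^sub>R v + r *\<^sub>R w \<in> S"
  obtains s r where "0 \<le> s" "s \<le> t" "0 \<le> r" "r \<le> t"
    "f (x + t *\<^sub>R v + t *\<^sub>R w) - f (x + t *\<^sub>R v) - f (x + t *\<^sub>R w) + f x =
     t\<^sup>2 * frechet_derivative (\<lambda>y. frechet_derivative f (at y) v) (at (x + s *\<^sub>R v + r *\<^sub>R w)) w"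
proof -
  have D: "((\<lambda>s. h (a + s *\<^sub>R u)) has_real_derivative frechet_derivative h (at (a + s *\<^sub>R u)) u) (at s)"
    if "smooth_on S h" "a + s *\<^sub>R u \<in> S" for h :: "'a \<Rightarrow> real" and a u s
  proof -
    have h: "(h has_derivative frechet_derivative h (at (a + s *\<^sub>R u))) (at (a + s *\<^sub>R u))"
      using smooth_on_imp_differentiable[OF that] by (simp add: frechet_derivative_works)
    have "((\<lambda>s. h (a + s *\<^sub>R u)) has_derivative (\<lambda>c. frechet_derivative h (at (a + s *\<^sub>R u)) (c *\<^sub>R u))) (at s)"
      by (rule has_derivative_compose[where f = "\<lambda>s. a + s *\<^sub>R u" and g = h, OF _ h]) (auto intro!: derivative_eq_intros)
    moreover have "frechet_derivative h (at (a + s *\<^sub>R u)) (c *\<^sub>R u) = frechet_derivative h (at (a + s *\<^sub>R u)) u * c" for c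
      using linear_cmul[OF linear_frechet_derivative[OF smooth_on_imp_differentiable[OF that]]] by simp
    ultimately show ?thesis by (simp add: has_field_derivative_def)
  qed
  define f1 where "f1 y = frechet_derivative f (at y) v" for y
  have f1: "smooth_on S f1"
    unfolding f1_def using smooth_on_frechet_derivative[OF f] .
  define \<phi> where "\<phi> s = f (x + t *\<^sub>R w + s *\<^sub>R v) - f (x + s *\<^sub>R v)" for s
  have "\<exists>s. 0 < s \<and> s < t \<and> \<phi> t - \<phi> 0 = (t - 0) * (f1 (x + t *\<^sub>R w + s *\<^sub>R v) - f1 (x + s *\<^sub>R v))"
  proof (rule MVT2[OF \<open>t > 0\<close>])
    fix s assume "0 \<le> s" "s \<le> t"
    then have "x + t *\<^sub>R w + s *\<^sub>R v \<in> S" "x + s *\<^sub>R v \<in> S"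
      using S[of s t] S[of s 0] \<open>t > 0\<close> by (simp_all add: algebra_simps)
    then show "(\<phi> has_real_derivative f1 (x + t *\<^sub>R w + s *\<^sub>R v) - f1 (x + s *\<^sub>R v)) (at s)"
      unfolding \<phi>_def f1_def by (intro DERIV_diff D f)
  qed
  then obtain s where s: "0 < s" "s < t"
    "\<phi> t - \<phi> 0 = t * (f1 (x + t *\<^sub>R w + s *\<^sub>R v) - f1 (x + s *\<^sub>R v))" by auto
  have "\<exists>r. 0 < r \<and> r < t \<and> f1 (x + s *\<^sub>R v + t *\<^sub>R w) - f1 (x + s *\<^sub>R v + 0 *\<^sub>R w) =
      (t - 0) * frechet_derivative f1 (at (x + s *\<^sub>R v + r *\<^sub>R w)) w"
    by (rule MVT2[OF \<open>t > 0\<close>]) (use s in \<open>intro D f1 S, auto\<close>)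
  then obtain r where r: "0 < r" "r < t" "f1 (x + s *\<^sub>R v + t *\<^sub>R w) - f1 (x + s *\<^sub>R v) =
      t * frechet_derivative f1 (at (x + s *\<^sub>R v + r *\<^sub>R w)) w" by auto
  have "\<phi> t - \<phi> 0 = t * (t * frechet_derivative f1 (at (x + s *\<^sub>R v + r *\<^sub>R w)) w)"
    unfolding r(3)[symmetric] s(3) by (simp add: algebra_simps)
  then have "f (x + t *\<^sub>R v + t *\<^sub>R w) - f (x + t *\<^sub>R v) - f (x + t *\<^sub>R w) + f x =
     t\<^sup>2 * frechet_derivative f1 (at (x + s *\<^sub>R v + r *\<^sub>R w)) w"
    by (simp add: \<phi>_def power2_eq_square algebra_simps)
  then show thesis using that[of s r] s r by (simp add: f1_def[abs_def])
qed

text \<open>The second difference is symmetric in \<open>v\<close> and \<open>w\<close>, so the two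
  mixed derivatives agree at some pair of points as close to \<open>x\<close> as desired. Continuity
  carries the equality to \<open>x\<close>.\<close>

lemma frechet_derivative_commute_real:
  fixes f :: "'a::real_normed_vector \<Rightarrow> real"
  assumes "open S" "smooth_on S f" "x \<in> S"
  shows "frechet_derivative (\<lambda>y. frechet_derivative f (at y) v) (at x) w =
    frechet_derivative (\<lambda>y. frechet_derivative f (at y) w) (at x) v"
proof -
  define F where "F v w y = frechet_derivative (\<lambda>y. frechet_derivative f (at y) v) (at y) w" for v w y
  have cont: "continuous_on S (F v w)" for v w
    unfolding F_def by (intro smooth_on_imp_continuous_on smooth_on_frechet_derivative assms)
  have "dist (F v w x) (F w v x) < e" if "e > 0" for e
  proof -
    have *: "\<exists>d>0. \<forall>y\<in>S. dist y x < d \<longrightarrow> dist (F v w y) (F v w x) < e / 2" for v w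
      using cont[of v w] assms(3) \<open>e > 0\<close> unfolding continuous_on_iff by (metis half_gt_zero)
    obtain d1 where d1: "d1 > 0" "\<And>y. y \<in> S \<Longrightarrow> dist y x < d1 \<Longrightarrow> dist (F v w y) (F v w x) < e / 2"
      using * by metis
    obtain d2 where d2: "d2 > 0" "\<And>y. y \<in> S \<Longrightarrow> dist y x < d2 \<Longrightarrow> dist (F w v y) (F w v x) < e / 2"
      using * by metis
    obtain d3 where d3: "d3 > 0" "\<And>y. dist y x < d3 \<Longrightarrow> y \<in> S"
      using assms(1,3) by (metis open_dist)
    define d where "d = min d1 (min d2 d3)"
    \<comment> \<open>Small enough for the whole parallelogram spanned by
      \<open>t *\<^sub>R v\<close> and \<open>t *\<^sub>R w\<close> to lie within \<open>d\<close>
      of \<open>x\<close>; the summand 1 keeps the denominator positive when both directions are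
      zero.\<close>
    define t where "t = d / (2 * (norm v + norm w + 1))"
    have n: "norm v + norm w + 1 > 0" by (smt (verit) norm_ge_zero)
    have "d > 0" using d1 d2 d3 by (simp add: d_def)
    then have "t > 0" using n by (simp add: t_def)
    have near: "dist (x + s *\<^sub>R v + r *\<^sub>R w) x < d" if "0 \<le> s" "s \<le> t" "0 \<le> r" "r \<le> t" for s r
    proof -
      have "dist (x + s *\<^sub>R v + r *\<^sub>R w) x \<le> s * norm v + r * norm w"
        using norm_triangle_ineq[of "s *\<^sub>R v" "r *\<^sub>R w"] that by (simp add: dist_norm add.assoc)
      also have "\<dots> \<le> t * norm v + t * norm w"
        using that by (intro add_mono mult_right_mono) auto
      also have "\<dots> \<le> t * (norm v + norm w + 1)"
        using \<open>t > 0\<close> by (simp add: algebra_simps)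
      also have "\<dots> = d / 2" using n by (simp add: t_def field_simps)
      finally show ?thesis using \<open>d > 0\<close> by simp
    qed
    have S: "x + s *\<^sub>R v + r *\<^sub>R w \<in> S" if "0 \<le> s" "s \<le> t" "0 \<le> r" "r \<le> t" for s r
      using near[OF that] d3 by (simp add: d_def)
    have near': "dist (x + s *\<^sub>R w + r *\<^sub>R v) x < d" and S': "x + s *\<^sub>R w + r *\<^sub>R v \<in> S"
      if "0 \<le> s" "s \<le> t" "0 \<le> r" "r \<le> t" for s r
      using near[of r s] S[of r s] that by (simp_all add: algebra_simps)
    obtain s r where 1: "0 \<le> s" "s \<le> t" "0 \<le> r" "r \<le> t"
      "f (x + t *\<^sub>R v + t *\<^sub>R w) - f (x + t *\<^sub>R v) - f (x + t *\<^sub>R w) + f x =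
       t\<^sup>2 * F v w (x + s *\<^sub>R v + r *\<^sub>R w)"
      using second_difference_mean_value[OF assms(2) \<open>t > 0\<close> S] unfolding F_def by blast
    obtain s' r' where 2: "0 \<le> s'" "s' \<le> t" "0 \<le> r'" "r' \<le> t"
      "f (x + t *\<^sub>R w + t *\<^sub>R v) - f (x + t *\<^sub>R w) - f (x + t *\<^sub>R v) + f x =
       t\<^sup>2 * F w v (x + s' *\<^sub>R w + r' *\<^sub>R v)"
      using second_difference_mean_value[OF assms(2) \<open>t > 0\<close> S'] unfolding F_def by blast
    have "t\<^sup>2 * F v w (x + s *\<^sub>R v + r *\<^sub>R w) = t\<^sup>2 * F w v (x + s' *\<^sub>R w + r' *\<^sub>R v)"
      using 1(5) 2(5) by (simp add: algebra_simps)
    then have "F v w (x + s *\<^sub>R v + r *\<^sub>R w) = F w v (x + s' *\<^sub>R w + r' *\<^sub>R v)"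
      using \<open>t > 0\<close> by simp
    moreover have "dist (F v w (x + s *\<^sub>R v + r *\<^sub>R w)) (F v w x) < e / 2"
      using d1(2)[OF S[OF 1(1-4)]] near[OF 1(1-4)] by (simp add: d_def)
    moreover have "dist (F w v (x + s' *\<^sub>R w + r' *\<^sub>R v)) (F w v x) < e / 2"
      using d2(2)[OF S'[OF 2(1-4)]] near'[OF 2(1-4)] by (simp add: d_def)
    ultimately show ?thesis by (metis dist_commute dist_triangle_half_l)
  qed
  then have "F v w x = F w v x" by (metis dist_self less_irrefl zero_less_dist_iff)
  then show ?thesis by (simp add: F_def)
qed

text \<open>The real case is applied to each component \<open>f y \<bullet> b\<close>, since taking
  an inner product commutes with differentiation.\<close>

lemma frechet_derivative_commute:
  fixes f :: "'a::real_normed_vector \<Rightarrow> 'b::euclidean_space"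
  assumes "open S" "smooth_on S f" "x \<in> S"
  shows "frechet_derivative (\<lambda>y. frechet_derivative f (at y) v) (at x) w =
    frechet_derivative (\<lambda>y. frechet_derivative f (at y) w) (at x) v"
proof (rule euclidean_eqI)
  fix b :: 'b
  have i: "frechet_derivative (\<lambda>y. h y \<bullet> b) (at y) u = frechet_derivative h (at y) u \<bullet> b"
    if "smooth_on S h" "y \<in> S" for h :: "'a \<Rightarrow> 'b" and y u
    using smooth_on_imp_differentiable[OF that] unfolding frechet_derivative_works
    by (subst frechet_derivative_at[OF has_derivative_inner_left, symmetric]) auto
  have ii: "frechet_derivative (\<lambda>y. frechet_derivative (\<lambda>y. f y \<bullet> b) (at y) u) (at x) u' =
      frechet_derivative (\<lambda>y. frechet_derivative f (at y) u) (at x) u' \<bullet> b" for u u'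
  proof -
    have "frechet_derivative (\<lambda>y. frechet_derivative (\<lambda>y. f y \<bullet> b) (at y) u) (at x) u' =
        frechet_derivative (\<lambda>y. frechet_derivative f (at y) u \<bullet> b) (at x) u'"
      by (rule arg_cong[where f = "\<lambda>F. F u'"], rule frechet_derivative_transform_within_open[OF _ assms(1,3)])
         (auto simp: i[OF assms(2)] intro!: smooth_on_imp_differentiable[OF _ assms(3)] smooth_on_frechet_derivative
            smooth_on_bounded_linear[OF bounded_linear_inner_left assms(1,2)])
    also have "\<dots> = frechet_derivative (\<lambda>y. frechet_derivative f (at y) u) (at x) u' \<bullet> b"
      by (rule i[OF smooth_on_frechet_derivative[OF assms(2)] assms(3)])
    finally show ?thesis .
  qed
  have "smooth_on S (\<lambda>y. f y \<bullet> b)"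
    by (rule smooth_on_bounded_linear[OF bounded_linear_inner_left assms(1,2)])
  then show "frechet_derivative (\<lambda>y. frechet_derivative f (at y) v) (at x) w \<bullet> b =
      frechet_derivative (\<lambda>y. frechet_derivative f (at y) w) (at x) v \<bullet> b"
    using frechet_derivative_commute_real[OF assms(1) _ assms(3)] by (simp flip: ii)
qed

section \<open>Vector fields as derivations\<close>

lemma dir_deriv_cong:
  assumes "open S" "x \<in> S" "\<And>y. y \<in> S \<Longrightarrow> f y = g y"
  shows "dir_deriv V f x = dir_deriv V g x"
proof -
  have "(f has_derivative f') (at x) \<longleftrightarrow> (g has_derivative f') (at x)" for f'
    using assms has_derivative_transform_within_open[OF _ assms(1,2)] by (metis (no_types, lifting))
  then show ?thesis by (simp add: dir_deriv_def frechet_derivative_def)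
qed

lemma dir_deriv_add:
  assumes "f differentiable (at x)" "h differentiable (at x)"
  shows "dir_deriv V (\<lambda>y. f y + h y) x = dir_deriv V f x + dir_deriv V h x"
  unfolding dir_deriv_def
  using has_derivative_add[OF assms[unfolded frechet_derivative_works]]
  by (simp add: frechet_derivative_at[symmetric])

lemma dir_deriv_diff:
  assumes "f differentiable (at x)" "h differentiable (at x)"
  shows "dir_deriv V (\<lambda>y. f y - h y) x = dir_deriv V f x - dir_deriv V h x"
  unfolding dir_deriv_def
  using has_derivative_diff[OF assms[unfolded frechet_derivative_works]]
  by (simp add: frechet_derivative_at[symmetric])

lemma dir_deriv_sum:
  assumes "\<And>i. i \<in> I \<Longrightarrow> f i differentiable (at x)"
  shows "dir_deriv V (\<lambda>y. \<Sum>i\<in>I. f i y) x = (\<Sum>i\<in>I. dir_deriv V (f i) x)"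
proof -
  have "((\<lambda>y. \<Sum>i\<in>I. f i y) has_derivative (\<lambda>v. \<Sum>i\<in>I. frechet_derivative (f i) (at x) v)) (at x)"
    by (intro has_derivative_sum) (simp add: assms flip: frechet_derivative_works)
  then show ?thesis
    by (simp add: dir_deriv_def frechet_derivative_at[symmetric])
qed

lemma dir_deriv_scaleR:
  assumes "f differentiable (at x)" "h differentiable (at x)"
  shows "dir_deriv V (\<lambda>y. f y *\<^sub>R h y) x = f x *\<^sub>R dir_deriv V h x + dir_deriv V f x *\<^sub>R h x"
  unfolding dir_deriv_def
  using has_derivative_scaleR[OF assms[unfolded frechet_derivative_works]]
  by (simp add: frechet_derivative_at[symmetric])

lemma dir_deriv_mult:
  fixes f h :: "real^'n::finite \<Rightarrow> real"
  assumes "f differentiable (at x)" "h differentiable (at x)"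
  shows "dir_deriv V (\<lambda>y. f y * h y) x = f x * dir_deriv V h x + dir_deriv V f x * h x"
  using dir_deriv_scaleR[OF assms] by simp

lemma dir_deriv_nth:
  fixes f :: "real^'n::finite \<Rightarrow> real^'m"
  assumes "f differentiable (at x)"
  shows "dir_deriv V (\<lambda>y. f y $ i) x = dir_deriv V f x $ i"
  unfolding dir_deriv_def
  using bounded_linear.has_derivative[OF bounded_linear_vec_nth[where i = i] assms[unfolded frechet_derivative_works]]
  by (simp add: frechet_derivative_at[symmetric])

lemma dir_deriv_const [simp]: "dir_deriv V (\<lambda>_. c) x = 0"
  by (simp add: dir_deriv_def)

lemma dir_deriv_field_cong: "V x = W x \<Longrightarrow> dir_deriv V f x = dir_deriv W f x"
  by (simp add: dir_deriv_def)

lemma dir_deriv_field_add: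
  "f differentiable (at x) \<Longrightarrow> dir_deriv (\<lambda>y. V y + W y) f x = dir_deriv V f x + dir_deriv W f x"
  by (simp add: dir_deriv_def linear_add[OF linear_frechet_derivative])

lemma dir_deriv_field_diff:
  "f differentiable (at x) \<Longrightarrow> dir_deriv (\<lambda>y. V y - W y) f x = dir_deriv V f x - dir_deriv W f x"
  by (simp add: dir_deriv_def linear_diff[OF linear_frechet_derivative])

lemma dir_deriv_field_scaleR:
  "f differentiable (at x) \<Longrightarrow> dir_deriv (\<lambda>y. a y *\<^sub>R V y) f x = a x *\<^sub>R dir_deriv V f x"
  by (simp add: dir_deriv_def linear_cmul[OF linear_frechet_derivative])

lemma dir_deriv_expand:
  assumes "f differentiable (at x)"
  shows "dir_deriv V f x = (\<Sum>i\<in>UNIV. V x $ i *\<^sub>R dir_deriv (frame i) f x)"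
proof -
  have "dir_deriv V f x = frechet_derivative f (at x) (\<Sum>i\<in>UNIV. V x $ i *\<^sub>R frame i x)"
    by (simp add: dir_deriv_def frame_expand)
  also have "\<dots> = (\<Sum>i\<in>UNIV. V x $ i *\<^sub>R dir_deriv (frame i) f x)"
    by (simp add: linear_sum[OF linear_frechet_derivative[OF assms]]
        linear_cmul[OF linear_frechet_derivative[OF assms]] dir_deriv_def)
  finally show ?thesis .
qed

lemma smooth_on_dir_deriv_frame:
  "smooth_on S f \<Longrightarrow> smooth_on S (dir_deriv (frame i) f)"
  using smooth_on_frechet_derivative[of S f "axis i 1"] by (simp add: dir_deriv_def[abs_def] frame_def)

text \<open>Smoothness provides derivatives in fixed directions only; expanding the field
  \<open>V\<close> in the coordinate frame reduces to those.\<close>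

lemma smooth_on_dir_deriv:
  assumes "open S" "smooth_on S V" "smooth_on S f"
  shows "smooth_on S (dir_deriv V f)"
proof -
  have "smooth_on S (\<lambda>x. \<Sum>i\<in>UNIV. V x $ i *\<^sub>R dir_deriv (frame i) f x)"
    by (intro smooth_on_sum smooth_on_scaleR smooth_on_nth assms smooth_on_dir_deriv_frame)
  then show ?thesis
    by (subst smooth_on_cong[OF assms(1) dir_deriv_expand])
       (auto intro: smooth_on_imp_differentiable assms)
qed

section \<open>Lie brackets\<close>

lemma smooth_on_lie_bracket:
  assumes "open S" "smooth_on S V" "smooth_on S W"
  shows "smooth_on S (lie_bracket V W)"
  unfolding lie_bracket_def[abs_def] by (intro smooth_on_diff smooth_on_dir_deriv assms)

text \<open>In coordinates V(Wf) splits into a second-order part, symmetric under exchange of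
  \<open>V\<close> and \<open>W\<close>, and the derivative of \<open>f\<close> along
  \<open>dir_deriv V W\<close>. Only the first-order parts survive in the difference. Vector-valued
  \<open>f\<close> is allowed so that \<open>f\<close> may itself be a vector field.\<close>

lemma dir_deriv_commutator:
  fixes f :: "real^'n::finite \<Rightarrow> 'b::euclidean_space"
  assumes "open S" "x \<in> S" "smooth_on S V" "smooth_on S W" "smooth_on S f"
  shows "dir_deriv V (dir_deriv W f) x - dir_deriv W (dir_deriv V f) x = dir_deriv (lie_bracket V W) f x"
proof -
  note d = smooth_on_imp_differentiable[OF _ assms(2)]
  have 1: "dir_deriv V (dir_deriv W f) x =
      dir_deriv (dir_deriv V W) f x + (\<Sum>i\<in>UNIV. \<Sum>j\<in>UNIV.
        (W x $ i * V x $ j) *\<^sub>R dir_deriv (frame j) (dir_deriv (frame i) f) x)"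
    if "smooth_on S V" "smooth_on S W" for V W
  proof -
    have "dir_deriv V (dir_deriv W f) x = dir_deriv V (\<lambda>y. \<Sum>i\<in>UNIV. W y $ i *\<^sub>R dir_deriv (frame i) f y) x"
      by (rule dir_deriv_cong[OF assms(1,2) dir_deriv_expand]) (rule smooth_on_imp_differentiable[OF assms(5)])
    also have "\<dots> = (\<Sum>i\<in>UNIV. dir_deriv V (\<lambda>y. W y $ i *\<^sub>R dir_deriv (frame i) f y) x)"
      by (intro dir_deriv_sum d smooth_on_scaleR smooth_on_nth smooth_on_dir_deriv_frame assms that)
    also have "\<dots> = (\<Sum>i\<in>UNIV. W x $ i *\<^sub>R dir_deriv V (dir_deriv (frame i) f) x
        + dir_deriv V W x $ i *\<^sub>R dir_deriv (frame i) f x)"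
      by (intro sum.cong refl, subst dir_deriv_scaleR)
         (auto intro!: d smooth_on_scaleR smooth_on_nth smooth_on_dir_deriv_frame assms that
           simp: dir_deriv_nth d[OF that(2)])
    also have "\<dots> = (\<Sum>i\<in>UNIV. W x $ i *\<^sub>R dir_deriv V (dir_deriv (frame i) f) x) + dir_deriv (dir_deriv V W) f x"
      by (simp add: sum.distrib dir_deriv_expand[OF d[OF assms(5)], of "dir_deriv V W"])
    also have "(\<Sum>i\<in>UNIV. W x $ i *\<^sub>R dir_deriv V (dir_deriv (frame i) f) x) =
       (\<Sum>i\<in>UNIV. \<Sum>j\<in>UNIV. (W x $ i * V x $ j) *\<^sub>R dir_deriv (frame j) (dir_deriv (frame i) f) x)"
      by (simp add: dir_deriv_expand[OF d[OF smooth_on_dir_deriv_frame[OF assms(5)]], of V] scaleR_sum_right)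
    finally show ?thesis by simp
  qed
  have sym: "dir_deriv (frame j) (dir_deriv (frame i) f) x = dir_deriv (frame i) (dir_deriv (frame j) f) x" for i j
    using frechet_derivative_commute[OF assms(1,5,2), of "axis i 1" "axis j 1"]
    by (simp add: dir_deriv_def[abs_def] frame_def)
  have "(\<Sum>i\<in>UNIV. \<Sum>j\<in>UNIV. (W x $ i * V x $ j) *\<^sub>R dir_deriv (frame j) (dir_deriv (frame i) f) x) =
      (\<Sum>i\<in>UNIV. \<Sum>j\<in>UNIV. (V x $ i * W x $ j) *\<^sub>R dir_deriv (frame j) (dir_deriv (frame i) f) x)"
    by (subst sum.swap) (simp add: sym mult.commute)
  then have "dir_deriv V (dir_deriv W f) x - dir_deriv W (dir_deriv V f) x =
      dir_deriv (dir_deriv V W) f x - dir_deriv (dir_deriv W V) f x"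
    by (simp add: 1 assms)
  then show ?thesis
    by (simp add: lie_bracket_def[abs_def] dir_deriv_field_diff d assms)
qed

text \<open>The commutator identity, applied to a field as the differentiated map, writes every
  double bracket as four iterated directional derivatives. The identity then holds by cancellation
  of these terms.\<close>

lemma lie_bracket_jacobi:
  fixes U V W :: "real^'n::finite \<Rightarrow> real^'n"
  assumes "open S" "x \<in> S" "smooth_on S U" "smooth_on S V" "smooth_on S W"
  shows "lie_bracket U (lie_bracket V W) x =
    lie_bracket (lie_bracket U V) W x + lie_bracket V (lie_bracket U W) x"
proof -
  note d = smooth_on_imp_differentiable[OF smooth_on_dir_deriv[OF assms(1)] assms(2)]
  have e: "lie_bracket A (lie_bracket B C) x =
      dir_deriv A (dir_deriv B C) x - dir_deriv A (dir_deriv C B) x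
      - (dir_deriv B (dir_deriv C A) x - dir_deriv C (dir_deriv B A) x)"
    if "smooth_on S A" "smooth_on S B" "smooth_on S C" for A B C
  proof -
    have "dir_deriv A (lie_bracket B C) x = dir_deriv A (dir_deriv B C) x - dir_deriv A (dir_deriv C B) x"
      unfolding lie_bracket_def[abs_def] by (intro dir_deriv_diff d that)
    moreover have "lie_bracket A (lie_bracket B C) x =
        dir_deriv A (lie_bracket B C) x - dir_deriv (lie_bracket B C) A x"
      by (simp only: lie_bracket_def[of A])
    ultimately show ?thesis
      using dir_deriv_commutator[OF assms(1,2) that(2,3,1)] by simp
  qed
  have "lie_bracket (lie_bracket U V) W x = - lie_bracket W (lie_bracket U V) x"
    by (simp add: lie_bracket_def[of _ W] lie_bracket_def[of W])
  then show ?thesis using assms by (simp add: e)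
qed


lemma lie_bracket_cong:
  assumes "open S" "x \<in> S" "\<And>y. y \<in> S \<Longrightarrow> A y = B y"
  shows "lie_bracket V A x = lie_bracket V B x"
  unfolding lie_bracket_def using dir_deriv_cong[OF assms] dir_deriv_field_cong[of A x B V] assms(2,3) by simp

lemma lie_bracket_diff_right:
  assumes "V differentiable (at x)" "A differentiable (at x)" "B differentiable (at x)"
  shows "lie_bracket V (\<lambda>y. A y - B y) x = lie_bracket V A x - lie_bracket V B x"
  using assms by (simp add: lie_bracket_def dir_deriv_diff dir_deriv_field_diff)

section \<open>The curvature tensor\<close>

lemma bil_add_left: "bil H (u + v) w = bil H u w + bil H v w"
  by (simp add: bil_def inner_add_left)

lemma bil_add_right: "bil H u (v + w) = bil H u v + bil H u w"
  by (simp add: bil_def inner_add_right matrix_vector_right_distrib)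

lemma bil_diff_left: "bil H (u - v) w = bil H u w - bil H v w"
  by (simp add: bil_def inner_diff_left)

lemma bil_diff_right: "bil H u (v - w) = bil H u v - bil H u w"
  by (simp add: bil_def inner_diff_right matrix_vector_mult_diff_distrib)

lemma bil_scaleR_left: "bil H (c *\<^sub>R v) w = c * bil H v w"
  by (simp add: bil_def)

lemma bil_scaleR_right: "bil H v (c *\<^sub>R w) = c * bil H v w"
  by (simp add: bil_def matrix_vector_mult_scaleR)

lemma bil_commute: "transpose H = H \<Longrightarrow> bil H u v = bil H v u"
  unfolding bil_def by (metis dot_lmul_matrix inner_commute transpose_matrix_vector)

text \<open>Testing with \<open>u = H *v v\<close> turns the pairing into the squared Euclidean norm
  of \<open>H *v v\<close>.\<close>

lemma bil_nondegenerate: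
  assumes "invertible H" "\<And>u. bil H u v = 0"
  shows "v = 0"
proof -
  have "H *v v = 0" using assms(2)[of "H *v v"] by (simp add: bil_def)
  then have "matrix_inv H *v (H *v v) = 0" by simp
  then show ?thesis using assms(1) by (simp add: matrix_vector_mul_assoc matrix_inv_cancel)
qed

text \<open>Each component of the connection term is a bilinear form, so linearity, smoothness and
  the product rule for \<open>bil\<close> carry over to it.\<close>

lemma christoffel_vec_bil: "christoffel_vec G x u v $ k = bil (\<chi> i j. christoffel G x k i j) u v"
  by (simp add: christoffel_vec_def bil_expand mult_ac)

lemma christoffel_vec_linear:
  "christoffel_vec G x (u + v) w = christoffel_vec G x u w + christoffel_vec G x v w"
  "christoffel_vec G x w (u + v) = christoffel_vec G x w u + christoffel_vec G x w v"
  "christoffel_vec G x (u - v) w = christoffel_vec G x u w - christoffel_vec G x v w"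
  "christoffel_vec G x w (u - v) = christoffel_vec G x w u - christoffel_vec G x w v"
  "christoffel_vec G x (c *\<^sub>R u) w = c *\<^sub>R christoffel_vec G x u w"
  "christoffel_vec G x w (c *\<^sub>R u) = c *\<^sub>R christoffel_vec G x w u"
  by (simp_all add: vec_eq_iff christoffel_vec_bil bil_add_left bil_add_right bil_diff_left bil_diff_right
      bil_scaleR_left bil_scaleR_right)

lemma cov_deriv_field_cong: "V x = W x \<Longrightarrow> cov_deriv G V Y x = cov_deriv G W Y x"
  by (simp add: cov_deriv_def dir_deriv_def)

lemma cov_deriv_cong:
  assumes "open S" "x \<in> S" "\<And>y. y \<in> S \<Longrightarrow> A y = B y"
  shows "cov_deriv G V A x = cov_deriv G V B x"
  using dir_deriv_cong[OF assms] assms(2,3) by (simp add: cov_deriv_def)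

lemma cov_deriv_add:
  assumes "A differentiable (at x)" "B differentiable (at x)"
  shows "cov_deriv G V (\<lambda>y. A y + B y) x = cov_deriv G V A x + cov_deriv G V B x"
  using assms by (simp add: cov_deriv_def dir_deriv_add christoffel_vec_linear)

lemma cov_deriv_field_add:
  assumes "A differentiable (at x)"
  shows "cov_deriv G (\<lambda>y. V y + W y) A x = cov_deriv G V A x + cov_deriv G W A x"
  using assms by (simp add: cov_deriv_def dir_deriv_field_add christoffel_vec_linear)

section \<open>Local calculus of a pseudo-Riemannian metric\<close>

text \<open>The picture of the manifold in one chart: \<open>S\<close> is the image of the chart and
  \<open>G\<close> the component matrix of the metric, with invertibility expressing
  nondegeneracy.\<close>

locale smooth_metric =
  fixes S :: "(real^'n::finite) set" and G :: "real^'n \<Rightarrow> real^'n^'n"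
  assumes open_S: "open S"
    and smooth_G: "smooth_on S G"
    and sym_G: "\<And>y. y \<in> S \<Longrightarrow> transpose (G y) = G y"
    and inv_G: "\<And>y. y \<in> S \<Longrightarrow> invertible (G y)"
begin

lemma smooth_on_christoffel: "smooth_on S (\<lambda>y. christoffel G y k i j)"
proof -
  have "smooth_on S (\<lambda>y. dir_deriv (frame a) (\<lambda>y. G y $ b $ c) y)" for a b c
    using smooth_on_dir_deriv_frame[OF smooth_on_nth[OF open_S smooth_on_nth[OF open_S smooth_G]]] .
  then show ?thesis
    unfolding christoffel_def
    by (intro smooth_on_divide smooth_on_const smooth_on_sum smooth_on_mult smooth_on_matrix_inv
        smooth_on_diff smooth_on_add open_S smooth_G inv_G) auto
qed

lemma smooth_on_bil:
  assumes "smooth_on S H" "smooth_on S Y" "smooth_on S W"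
  shows "smooth_on S (\<lambda>y. bil (H y) (Y y) (W y))"
  unfolding bil_def
  by (intro smooth_on_bilinear[OF bounded_bilinear_inner] smooth_on_bilinear[OF bilinear_mult_vec] open_S assms)

lemma smooth_on_christoffel_matrix: "smooth_on S (\<lambda>y. \<chi> i j. christoffel G y k i j)"
  by (intro smooth_on_vec_lambda smooth_on_christoffel open_S)

lemma smooth_on_christoffel_vec:
  assumes "smooth_on S Y" "smooth_on S W"
  shows "smooth_on S (\<lambda>y. christoffel_vec G y (Y y) (W y))"
proof -
  have "smooth_on S (\<lambda>y. \<chi> k. christoffel_vec G y (Y y) (W y) $ k)"
    unfolding christoffel_vec_bil
    by (intro smooth_on_vec_lambda open_S smooth_on_bil smooth_on_christoffel_matrix assms)
  then show ?thesis by simp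
qed

lemma smooth_on_cov_deriv:
  assumes "smooth_on S Y" "smooth_on S W"
  shows "smooth_on S (cov_deriv G Y W)"
  unfolding cov_deriv_def[abs_def]
  by (intro smooth_on_add smooth_on_dir_deriv smooth_on_christoffel_vec open_S assms)

text \<open>The derivative of the Christoffel symbols in direction \<open>u\<close>, contracted with
  \<open>v\<close> and \<open>w\<close>: the extra term in the product rule for the connection
  term.\<close>

definition christoffel_deriv :: "real^'n \<Rightarrow> real^'n \<Rightarrow> real^'n \<Rightarrow> real^'n \<Rightarrow> real^'n" where
  "christoffel_deriv x u v w =
     (\<chi> k. bil (dir_deriv (\<lambda>_. u) (\<lambda>y. \<chi> i j. christoffel G y k i j) x) v w)"

lemma dir_deriv_christoffel_vec:
  assumes "x \<in> S" "smooth_on S Y" "smooth_on S W"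
  shows "dir_deriv V (\<lambda>y. christoffel_vec G y (Y y) (W y)) x =
    christoffel_deriv x (V x) (Y x) (W x) + christoffel_vec G x (dir_deriv V Y x) (W x)
    + christoffel_vec G x (Y x) (dir_deriv V W x)"
proof -
  note d = smooth_on_imp_differentiable[OF _ assms(1)]
  have "dir_deriv V (\<lambda>y. christoffel_vec G y (Y y) (W y)) x $ k =
      dir_deriv V (\<lambda>y. bil (\<chi> i j. christoffel G y k i j) (Y y) (W y)) x" for k
    unfolding christoffel_vec_bil[symmetric]
    by (rule dir_deriv_nth[symmetric]) (intro d smooth_on_christoffel_vec assms)
  then show ?thesis
    by (simp add: vec_eq_iff dir_deriv_bil d smooth_on_christoffel_matrix assms
        christoffel_deriv_def christoffel_vec_bil dir_deriv_field_cong[of V x "\<lambda>_. V x"])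
qed

text \<open>The coordinate formula for the curvature, of the shape d\<Gamma> + \<Gamma>\<Gamma>, as
  a function of tangent vectors instead of vector fields.\<close>

definition riemann :: "real^'n \<Rightarrow> real^'n \<Rightarrow> real^'n \<Rightarrow> real^'n \<Rightarrow> real^'n" where
  "riemann x u v w = christoffel_deriv x u v w - christoffel_deriv x v u w
     + christoffel_vec G x u (christoffel_vec G x v w) - christoffel_vec G x v (christoffel_vec G x u w)"

text \<open>Tensoriality: second derivatives of \<open>W\<close> and first derivatives of
  \<open>X\<close> and \<open>Y\<close> cancel against the bracket term, and first derivatives of
  \<open>W\<close> enter symmetrically in \<open>X\<close> and \<open>Y\<close>.\<close>

lemma curvature_eq_riemann:
  assumes "x \<in> S" "smooth_on S X" "smooth_on S Y" "smooth_on S W"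
  shows "curvature G X Y W x = riemann x (X x) (Y x) (W x)"
proof -
  note d = smooth_on_imp_differentiable[OF _ assms(1)]
  have 1: "cov_deriv G X (cov_deriv G Y W) x =
      dir_deriv X (dir_deriv Y W) x
      + christoffel_deriv x (X x) (Y x) (W x) + christoffel_vec G x (dir_deriv X Y x) (W x)
      + christoffel_vec G x (Y x) (dir_deriv X W x)
      + christoffel_vec G x (X x) (dir_deriv Y W x) + christoffel_vec G x (X x) (christoffel_vec G x (Y x) (W x))"
    if "smooth_on S X" "smooth_on S Y" for X Y
  proof -
    have "dir_deriv X (cov_deriv G Y W) x = dir_deriv X (dir_deriv Y W) x
        + dir_deriv X (\<lambda>y. christoffel_vec G y (Y y) (W y)) x"
      unfolding cov_deriv_def[abs_def]
      by (intro dir_deriv_add d smooth_on_dir_deriv smooth_on_christoffel_vec open_S assms that)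
    then show ?thesis
      unfolding cov_deriv_def[of G X]
      by (simp add: dir_deriv_christoffel_vec assms that cov_deriv_def christoffel_vec_linear)
  qed
  have "cov_deriv G (lie_bracket X Y) W x = dir_deriv X (dir_deriv Y W) x - dir_deriv Y (dir_deriv X W) x
      + christoffel_vec G x (dir_deriv X Y x) (W x) - christoffel_vec G x (dir_deriv Y X x) (W x)"
    using dir_deriv_commutator[OF open_S assms]
    by (simp add: cov_deriv_def lie_bracket_def[of X Y x] christoffel_vec_linear)
  then show ?thesis
    by (simp add: curvature_def 1 assms riemann_def)
qed

lemma linear_riemann:
  assumes "x \<in> S"
  shows "linear (\<lambda>u. riemann x u v w)" "linear (\<lambda>v. riemann x u v w)" "linear (\<lambda>w. riemann x u v w)"
proof -
  note f = smooth_on_imp_differentiable[OF smooth_on_christoffel_matrix assms]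
  have K: "christoffel_deriv x (u + u') v w = christoffel_deriv x u v w + christoffel_deriv x u' v w"
    "christoffel_deriv x (c *\<^sub>R u) v w = c *\<^sub>R christoffel_deriv x u v w"
    "christoffel_deriv x u (v + v') w = christoffel_deriv x u v w + christoffel_deriv x u v' w"
    "christoffel_deriv x u (c *\<^sub>R v) w = c *\<^sub>R christoffel_deriv x u v w"
    "christoffel_deriv x u v (w + w') = christoffel_deriv x u v w + christoffel_deriv x u v w'"
    "christoffel_deriv x u v (c *\<^sub>R w) = c *\<^sub>R christoffel_deriv x u v w" for c u u' v v' w w'
    by (simp_all add: vec_eq_iff christoffel_deriv_def bil_add_left bil_add_right bil_scaleR_left bil_scaleR_right
        dir_deriv_field_add[OF f, of "\<lambda>_. u" "\<lambda>_. u'"] dir_deriv_field_scaleR[OF f, of "\<lambda>_. c" "\<lambda>_. u"])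
       (simp_all add: bil_def matrix_vector_mult_add_rdistrib inner_add_right flip: scaleR_matrix_vector_assoc)
  show "linear (\<lambda>u. riemann x u v w)" "linear (\<lambda>v. riemann x u v w)" "linear (\<lambda>w. riemann x u v w)"
    by (auto intro!: linearI simp: riemann_def K christoffel_vec_linear algebra_simps)
qed

lemma smooth_on_curvature:
  assumes "smooth_on S X" "smooth_on S Y" "smooth_on S W"
  shows "smooth_on S (curvature G X Y W)"
  unfolding curvature_def[abs_def]
  by (intro smooth_on_diff smooth_on_cov_deriv smooth_on_lie_bracket open_S assms)

text \<open>\<open>local_ricci\<close> is given by its frame components; trilinearity of
  \<open>riemann\<close> extends the trace formula to arbitrary vectors.\<close>

lemma local_ricci_apply:
  assumes "x \<in> S"
  shows "bil (local_ricci G x) v w = (\<Sum>i\<in>UNIV. riemann x (frame i x) v w $ i)"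
proof -
  have s: "smooth_on S (frame i)" for i :: 'n by (simp add: frame_def smooth_on_const)
  note l = linear_riemann[OF assms]
  have "riemann x u v w = (\<Sum>j\<in>UNIV. \<Sum>k\<in>UNIV. (v $ j * w $ k) *\<^sub>R riemann x u (frame j x) (frame k x))" for u
  proof -
    have "riemann x u v w = riemann x u (\<Sum>j\<in>UNIV. v $ j *\<^sub>R frame j x) (\<Sum>k\<in>UNIV. w $ k *\<^sub>R frame k x)"
      by (simp add: frame_expand)
    also have "\<dots> = (\<Sum>j\<in>UNIV. \<Sum>k\<in>UNIV. (v $ j * w $ k) *\<^sub>R riemann x u (frame j x) (frame k x))"
      by (simp only: linear_sum[OF l(2)] linear_cmul[OF l(2)], simp only: linear_sum[OF l(3)] linear_cmul[OF l(3)]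
          scaleR_sum_right scaleR_scaleR)
    finally show ?thesis .
  qed
  then have "(\<Sum>i\<in>UNIV. riemann x (frame i x) v w $ i) =
      (\<Sum>i\<in>UNIV. \<Sum>j\<in>UNIV. \<Sum>k\<in>UNIV. v $ j * w $ k * riemann x (frame i x) (frame j x) (frame k x) $ i)"
    by simp
  also have "\<dots> = (\<Sum>j\<in>UNIV. \<Sum>k\<in>UNIV. \<Sum>i\<in>UNIV. v $ j * w $ k * riemann x (frame i x) (frame j x) (frame k x) $ i)"
    by (subst sum.swap) (intro sum.cong refl sum.swap)
  also have "\<dots> = bil (local_ricci G x) v w"
    by (simp add: bil_expand local_ricci_def curvature_eq_riemann[OF assms s s s] sum_distrib_left sum_distrib_right mult_ac)
  finally show ?thesis by simp
qed

end

section \<open>Killing fields preserve the Ricci tensor\<close>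

text \<open>The identity tr(fh) = tr(hf), written in components. It removes the frame-dependent
  terms when the Ricci trace is differentiated.\<close>

lemma trace_linear_commute:
  fixes f h :: "real^'n::finite \<Rightarrow> real^'n"
  assumes "linear f" "linear h"
  shows "(\<Sum>i\<in>UNIV. f (h (axis i 1)) $ i) = (\<Sum>i\<in>UNIV. h (f (axis i 1)) $ i)"
proof -
  have t: "trace (matrix a) = (\<Sum>i\<in>UNIV. a (axis i 1) $ i)" for a :: "real^'n \<Rightarrow> real^'n"
    by (simp add: trace_def matrix_def)
  have "trace (matrix (f \<circ> h)) = trace (matrix (h \<circ> f))"
    unfolding matrix_compose[OF assms(2,1)] matrix_compose[OF assms] by (rule trace_mul_sym)
  then show ?thesis by (simp add: t)
qed

locale killing_metric = smooth_metric S G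
  for S :: "(real^'n::finite) set" and G :: "real^'n \<Rightarrow> real^'n^'n" +
  fixes Z :: "real^'n \<Rightarrow> real^'n"
  assumes smooth_Z: "smooth_on S Z"
    and killing: "\<And>x. x \<in> S \<Longrightarrow> local_lie_deriv2 Z G x = 0"
begin

text \<open>The Killing equation as a Leibniz rule: \<open>local_lie_deriv2_apply\<close> passes
  from the coordinate frame to arbitrary fields.\<close>

lemma dir_deriv_metric:
  assumes "x \<in> S" "smooth_on S Y" "smooth_on S W"
  shows "dir_deriv Z (\<lambda>y. bil (G y) (Y y) (W y)) x =
    bil (G x) (lie_bracket Z Y x) (W x) + bil (G x) (Y x) (lie_bracket Z W x)"
proof -
  note d = smooth_on_imp_differentiable[OF _ assms(1)]
  show ?thesis
    using local_lie_deriv2_apply[OF d[OF smooth_G] d[OF assms(2)] d[OF assms(3)] d[OF smooth_Z]] killing[OF assms(1)]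
    by (simp add: bil_def)
qed

text \<open>Infinitesimal form of the fact that isometries preserve the Levi-Civita connection. The
  argument is the one that proves uniqueness of that connection, applied to the defect
  \<open>D\<close>.\<close>

lemma lie_bracket_cov_deriv:
  assumes "x \<in> S" "smooth_on S X" "smooth_on S Y"
  shows "lie_bracket Z (cov_deriv G X Y) x =
    cov_deriv G (lie_bracket Z X) Y x + cov_deriv G X (lie_bracket Z Y) x"
proof -
  note d = smooth_on_imp_differentiable[OF _ assms(1)]
  note sb = smooth_on_lie_bracket[OF open_S smooth_Z]
  define D where "D X Y = lie_bracket Z (cov_deriv G X Y) x
      - cov_deriv G (lie_bracket Z X) Y x - cov_deriv G X (lie_bracket Z Y) x" for X Y
  have metric: "dir_deriv V (\<lambda>y. bil (G y) (Y y) (W y)) y =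
     bil (G y) (cov_deriv G V Y y) (W y) + bil (G y) (Y y) (cov_deriv G V W y)"
    if "y \<in> S" "smooth_on S Y" "smooth_on S W" for V Y W y
    by (intro cov_deriv_metric[where G = G, OF open_S that(1) sym_G inv_G[OF that(1)]]
        smooth_on_imp_differentiable[OF _ that(1)] smooth_G that)
  \<comment> \<open>Bracketing the torsion identity with \<open>Z\<close> and expanding by Jacobi
    leaves the torsion identities of the pairs ([Z,X], Y) and (X, [Z,Y]).\<close>
  have sym: "D X Y = D Y X" if "smooth_on S X" "smooth_on S Y" for X Y
  proof -
    have torsion: "cov_deriv G U V y - cov_deriv G V U y = lie_bracket U V y" if "y \<in> S" for U V y
      using cov_deriv_torsion_free(1)[OF open_S that sym_G smooth_on_imp_differentiable[OF smooth_G that]] .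
    have "lie_bracket Z (cov_deriv G X Y) x - lie_bracket Z (cov_deriv G Y X) x =
        lie_bracket Z (\<lambda>y. cov_deriv G X Y y - cov_deriv G Y X y) x"
      by (intro lie_bracket_diff_right[symmetric] d smooth_on_cov_deriv that smooth_Z)
    also have "\<dots> = lie_bracket Z (lie_bracket X Y) x"
      by (intro lie_bracket_cong[OF open_S assms(1)] torsion)
    also have "\<dots> = lie_bracket (lie_bracket Z X) Y x + lie_bracket X (lie_bracket Z Y) x"
      by (intro lie_bracket_jacobi[OF open_S assms(1)] smooth_Z that)
    finally show ?thesis
      using torsion[OF assms(1), of "lie_bracket Z X" Y] torsion[OF assms(1), of X "lie_bracket Z Y"]
      by (simp add: D_def algebra_simps)
  qed
  \<comment> \<open>Differentiating g(Y,W) along \<open>X\<close> and \<open>Z\<close> in both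
    orders gives \<open>1\<close> and \<open>2\<close>. Their difference is the derivative along
    [Z,X]; products of one covariant derivative and one bracket cancel, and the rest is the defect
    in both slots.\<close>
  have skew: "bil (G x) (D X Y) (W x) = - bil (G x) (Y x) (D X W)"
    if X: "smooth_on S X" and Y: "smooth_on S Y" and W: "smooth_on S W" for X Y W
  proof -
    let ?h = "\<lambda>y. bil (G y) (Y y) (W y)"
    have h: "smooth_on S ?h" by (intro smooth_on_bil smooth_G Y W)
    have "dir_deriv Z (dir_deriv X ?h) x =
        dir_deriv Z (\<lambda>y. bil (G y) (cov_deriv G X Y y) (W y) + bil (G y) (Y y) (cov_deriv G X W y)) x"
      by (intro dir_deriv_cong[OF open_S assms(1)] metric Y W)
    also have "\<dots> = dir_deriv Z (\<lambda>y. bil (G y) (cov_deriv G X Y y) (W y)) x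
        + dir_deriv Z (\<lambda>y. bil (G y) (Y y) (cov_deriv G X W y)) x"
      by (intro dir_deriv_add d smooth_on_bil smooth_G smooth_on_cov_deriv X Y W)
    finally have 1: "dir_deriv Z (dir_deriv X ?h) x =
        bil (G x) (lie_bracket Z (cov_deriv G X Y) x) (W x) + bil (G x) (cov_deriv G X Y x) (lie_bracket Z W x)
        + bil (G x) (lie_bracket Z Y x) (cov_deriv G X W x) + bil (G x) (Y x) (lie_bracket Z (cov_deriv G X W) x)"
      by (simp add: dir_deriv_metric[OF assms(1)] smooth_on_cov_deriv X Y W)
    have "dir_deriv X (dir_deriv Z ?h) x =
        dir_deriv X (\<lambda>y. bil (G y) (lie_bracket Z Y y) (W y) + bil (G y) (Y y) (lie_bracket Z W y)) x"
      by (intro dir_deriv_cong[OF open_S assms(1)] dir_deriv_metric Y W)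
    also have "\<dots> = dir_deriv X (\<lambda>y. bil (G y) (lie_bracket Z Y y) (W y)) x
        + dir_deriv X (\<lambda>y. bil (G y) (Y y) (lie_bracket Z W y)) x"
      by (intro dir_deriv_add d smooth_on_bil smooth_G sb Y W)
    finally have 2: "dir_deriv X (dir_deriv Z ?h) x =
        bil (G x) (cov_deriv G X (lie_bracket Z Y) x) (W x) + bil (G x) (lie_bracket Z Y x) (cov_deriv G X W x)
        + bil (G x) (cov_deriv G X Y x) (lie_bracket Z W x) + bil (G x) (Y x) (cov_deriv G X (lie_bracket Z W) x)"
      by (simp add: metric[OF assms(1)] sb Y W)
    have "dir_deriv (lie_bracket Z X) ?h x =
        bil (G x) (cov_deriv G (lie_bracket Z X) Y x) (W x) + bil (G x) (Y x) (cov_deriv G (lie_bracket Z X) W x)"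
      by (intro metric assms(1) Y W)
    then show ?thesis
      using dir_deriv_commutator[OF open_S assms(1) smooth_Z X h] unfolding 1 2 D_def
      by (simp add: bil_diff_left bil_diff_right)
  qed
  \<comment> \<open>A trilinear form symmetric in its first and skew in its last two arguments vanishes.\<close>
  have "bil (G x) w (D X Y) = 0" for w
  proof -
    \<comment> \<open>The vector is extended to a field because the exchanges below also move it
      into the arguments of \<open>D\<close>.\<close>
    define W where "W = (\<lambda>_::real^'n. w)"
    note s = assms(2,3) smooth_on_const[of S w, folded W_def]
    define c where "c A B C = bil (G x) (D A B) (C x)" for A B C
    have c1: "c A B C = c B A C" if "smooth_on S A" "smooth_on S B" for A B C
      using sym[OF that] by (simp add: c_def)
    have c2: "c A B C = - c A C B" if "smooth_on S A" "smooth_on S B" "smooth_on S C" for A B C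
      using skew[OF that] bil_commute[OF sym_G[OF assms(1)]] by (simp add: c_def)
    \<comment> \<open>Six exchanges, alternately of the first and of the last two arguments, restore
      the order; three of them change the sign.\<close>
    have "c X Y W = - c X Y W"
      using c1[OF s(1,2), of W] c2[OF s(2,1,3)] c1[OF s(2,3), of X] c2[OF s(3,2,1)] c1[OF s(3,1), of Y] c2[OF s(1,3,2)]
      by linarith
    then show ?thesis
      using bil_commute[OF sym_G[OF assms(1)]] by (simp add: c_def W_def)
  qed
  then have "D X Y = 0" using bil_nondegenerate inv_G assms(1) by blast
  then show ?thesis by (simp add: D_def algebra_simps)
qed

text \<open>The curvature is built from the connection and the bracket, and bracketing with
  \<open>Z\<close> is a derivation of both, by \<open>lie_bracket_cov_deriv\<close> and
  \<open>lie_bracket_jacobi\<close>.\<close>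

lemma lie_bracket_curvature:
  assumes "x \<in> S" "smooth_on S X" "smooth_on S Y" "smooth_on S W"
  shows "lie_bracket Z (curvature G X Y W) x =
    curvature G (lie_bracket Z X) Y W x + curvature G X (lie_bracket Z Y) W x
    + curvature G X Y (lie_bracket Z W) x"
proof -
  note d = smooth_on_imp_differentiable[OF _ assms(1)]
  note sb = smooth_on_lie_bracket[OF open_S]
  have 1: "lie_bracket Z (cov_deriv G X (cov_deriv G Y W)) x =
      cov_deriv G (lie_bracket Z X) (cov_deriv G Y W) x
      + cov_deriv G X (cov_deriv G (lie_bracket Z Y) W) x
      + cov_deriv G X (cov_deriv G Y (lie_bracket Z W)) x"
    if "smooth_on S X" "smooth_on S Y" for X Y
  proof -
    have "cov_deriv G X (lie_bracket Z (cov_deriv G Y W)) x =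
        cov_deriv G X (\<lambda>y. cov_deriv G (lie_bracket Z Y) W y + cov_deriv G Y (lie_bracket Z W) y) x"
      by (intro cov_deriv_cong[OF open_S assms(1)] lie_bracket_cov_deriv that assms)
    also have "\<dots> = cov_deriv G X (cov_deriv G (lie_bracket Z Y) W) x
        + cov_deriv G X (cov_deriv G Y (lie_bracket Z W)) x"
      by (intro cov_deriv_add d smooth_on_cov_deriv sb smooth_Z that assms)
    finally show ?thesis
      using lie_bracket_cov_deriv[OF assms(1) that(1) smooth_on_cov_deriv[OF that(2) assms(4)]] by simp
  qed
  have "cov_deriv G (lie_bracket Z (lie_bracket X Y)) W x =
      cov_deriv G (\<lambda>y. lie_bracket (lie_bracket Z X) Y y + lie_bracket X (lie_bracket Z Y) y) W x"
    by (intro cov_deriv_field_cong lie_bracket_jacobi[OF open_S assms(1)] smooth_Z assms)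
  also have "\<dots> = cov_deriv G (lie_bracket (lie_bracket Z X) Y) W x
      + cov_deriv G (lie_bracket X (lie_bracket Z Y)) W x"
    by (intro cov_deriv_field_add d assms)
  finally have 2: "lie_bracket Z (cov_deriv G (lie_bracket X Y) W) x =
      cov_deriv G (lie_bracket (lie_bracket Z X) Y) W x + cov_deriv G (lie_bracket X (lie_bracket Z Y)) W x
      + cov_deriv G (lie_bracket X Y) (lie_bracket Z W) x"
    using lie_bracket_cov_deriv[OF assms(1) sb[OF assms(2,3)] assms(4)] by simp
  have "lie_bracket Z (curvature G X Y W) x =
      lie_bracket Z (\<lambda>y. cov_deriv G X (cov_deriv G Y W) y - cov_deriv G Y (cov_deriv G X W) y) x
      - lie_bracket Z (cov_deriv G (lie_bracket X Y) W) x"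
    unfolding curvature_def[abs_def]
    by (intro lie_bracket_diff_right d smooth_on_diff smooth_on_cov_deriv sb smooth_Z open_S assms)
  also have "lie_bracket Z (\<lambda>y. cov_deriv G X (cov_deriv G Y W) y - cov_deriv G Y (cov_deriv G X W) y) x =
      lie_bracket Z (cov_deriv G X (cov_deriv G Y W)) x - lie_bracket Z (cov_deriv G Y (cov_deriv G X W)) x"
    by (intro lie_bracket_diff_right d smooth_on_cov_deriv smooth_Z assms)
  finally show ?thesis
    unfolding 1[OF assms(2,3)] 1[OF assms(3,2)] 2 by (simp add: curvature_def[of _ _ _ _ x])
qed

text \<open>The Ricci tensor is a trace of the curvature, which \<open>Z\<close> preserves. The
  coordinate frame in that trace is not preserved, but the derivative \<open>L\<close> of
  \<open>Z\<close> enters only through the traces of LT and TL, with opposite signs.\<close>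

lemma dir_deriv_ricci:
  assumes "x \<in> S" "smooth_on S Y" "smooth_on S W"
  shows "dir_deriv Z (\<lambda>y. bil (local_ricci G y) (Y y) (W y)) x =
    bil (local_ricci G x) (lie_bracket Z Y x) (W x) + bil (local_ricci G x) (Y x) (lie_bracket Z W x)"
proof -
  note d = smooth_on_imp_differentiable[OF _ assms(1)]
  note sb = smooth_on_lie_bracket[OF open_S smooth_Z]
  have sf: "smooth_on S (frame i)" for i :: 'n by (simp add: frame_def smooth_on_const)
  define L where "L = frechet_derivative Z (at x)"
  have L: "linear L" unfolding L_def by (intro linear_frechet_derivative d smooth_Z)
  define T where "T u = riemann x u (Y x) (W x)" for u
  have T: "linear T" unfolding T_def by (intro linear_riemann assms)
  have br: "lie_bracket Z (frame i) x = - L (frame i x)" for i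
    by (simp add: lie_bracket_def dir_deriv_frame L_def) (simp add: dir_deriv_def)
  have c: "smooth_on S (curvature G (frame i) Y W)" for i
    by (intro smooth_on_curvature sf assms)
  \<comment> \<open>Passing from the bracket to the coordinate derivative adds \<open>L\<close>
    applied to the curvature vector, and the bracket of \<open>Z\<close> with a frame field is
    \<open>- L\<close> of that field. This puts \<open>L\<close> on either side of
    \<open>T\<close>.\<close>
  have e: "dir_deriv Z (curvature G (frame i) Y W) x =
      - T (L (frame i x)) + riemann x (frame i x) (lie_bracket Z Y x) (W x)
      + riemann x (frame i x) (Y x) (lie_bracket Z W x) + L (T (frame i x))" for i
  proof -
    have "dir_deriv Z (curvature G (frame i) Y W) x =
        lie_bracket Z (curvature G (frame i) Y W) x + L (curvature G (frame i) Y W x)"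
      by (simp add: lie_bracket_def L_def dir_deriv_def[of "curvature G (frame i) Y W"])
    then show ?thesis
      by (simp add: lie_bracket_curvature curvature_eq_riemann sb sf assms br T_def
          linear_neg[OF linear_riemann(1)[OF assms(1)]])
  qed
  have "dir_deriv Z (\<lambda>y. bil (local_ricci G y) (Y y) (W y)) x =
      dir_deriv Z (\<lambda>y. \<Sum>i\<in>UNIV. curvature G (frame i) Y W y $ i) x"
    by (rule dir_deriv_cong[OF open_S assms(1)])
       (simp add: local_ricci_apply curvature_eq_riemann sf assms)
  also have "\<dots> = (\<Sum>i\<in>UNIV. dir_deriv Z (curvature G (frame i) Y W) x $ i)"
    by (subst dir_deriv_sum) (auto intro!: sum.cong d smooth_on_nth[OF open_S c] simp: dir_deriv_nth[OF d[OF c]])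
  also have "\<dots> = bil (local_ricci G x) (lie_bracket Z Y x) (W x) + bil (local_ricci G x) (Y x) (lie_bracket Z W x)"
    using trace_linear_commute[OF T L]
    by (simp add: e sum.distrib sum_negf sum_subtractf local_ricci_apply assms(1)) (simp add: frame_def)
  finally show ?thesis .
qed

text \<open>The Killing identity for the pair (Z, W), combined with metric compatibility and
  vanishing torsion, equates the pairing of \<nabla>_Z Z with \<open>W\<close> and minus that of
  \<open>Z\<close> with \<nabla>_W Z. The latter vanishes because \<open>Z\<close> has constant
  length.\<close>

lemma cov_deriv_self_eq_0:
  assumes "x \<in> S" and unit: "\<And>y. y \<in> S \<Longrightarrow> bil (G y) (Z y) (Z y) = - 1"
  shows "cov_deriv G Z Z x = 0"
proof -
  note d = smooth_on_imp_differentiable[OF _ assms(1)]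
  note metric = cov_deriv_metric[OF open_S assms(1) sym_G inv_G[OF assms(1)] d[OF smooth_G]]
  note sym = bil_commute[OF sym_G[OF assms(1)]]
  have "bil (G x) w (cov_deriv G Z Z x) = 0" for w
  proof -
    define W where "W = (\<lambda>_::real^'n. w)"
    have W: "smooth_on S W" by (simp add: W_def smooth_on_const)
    have "dir_deriv W (\<lambda>y. bil (G y) (Z y) (Z y)) x = dir_deriv W (\<lambda>_. -1 :: real) x"
      by (rule dir_deriv_cong[OF open_S assms(1)]) (rule unit)
    then have "bil (G x) (Z x) (cov_deriv G W Z x) = 0"
      using metric[of Z Z W] d[OF smooth_Z] sym[of "Z x" "cov_deriv G W Z x"] by simp
    moreover have "bil (G x) (cov_deriv G Z Z x) w + bil (G x) (Z x) (cov_deriv G Z W x) =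
        bil (G x) (lie_bracket Z Z x) w + bil (G x) (Z x) (lie_bracket Z W x)"
      using metric[of Z W Z] dir_deriv_metric[OF assms(1) smooth_Z W] d[OF smooth_Z] d[OF W]
      by (simp add: W_def)
    moreover have "lie_bracket Z W x = cov_deriv G Z W x - cov_deriv G W Z x"
      using cov_deriv_torsion_free(1)[OF open_S assms(1) sym_G d[OF smooth_G]] by simp
    moreover have "lie_bracket Z Z x = 0" by (simp add: lie_bracket_def)
    ultimately have "bil (G x) (cov_deriv G Z Z x) w = 0"
      by (simp add: bil_diff_right) (simp add: bil_def)
    then show ?thesis using sym[of w "cov_deriv G Z Z x"] by simp
  qed
  then show ?thesis using bil_nondegenerate inv_G assms(1) by blast
qed

end

section \<open>Perfect fluids\<close>

lemma bil_covector_tensor: "bil (covector_tensor a b) u v = (a \<bullet> u) * (b \<bullet> v)"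
  by (simp add: bil_expand covector_tensor_def inner_vec_def sum_product mult_ac)

lemma bil_scaleR: "bil (c *\<^sub>R H) u v = c * bil H u v"
  by (simp add: bil_def flip: scaleR_matrix_vector_assoc)

lemma bil_add: "bil (H + K) u v = bil H u v + bil K u v"
  by (simp add: bil_def matrix_vector_mult_add_rdistrib inner_add_right)

text \<open>In dimension at least 2 some nonzero vector is orthogonal to \<open>z\<close>; inserting
  it removes the second term, and nondegeneracy gives \<open>a = 0\<close>. Evaluation at (z,z) then
  gives \<open>b = 0\<close>.\<close>

lemma metric_covector_independent:
  fixes H :: "real^'n::finite^'n"
  assumes "CARD('n) \<ge> 2" "transpose H = H" "invertible H" "bil H z z = -1"
    and "\<And>u v. a * bil H u v + b * (bil H u z * bil H v z) = 0"
  shows "a = 0" "b = 0"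
proof -
  \<comment> \<open>Euclidean orthogonality to \<open>H *v z\<close> is orthogonality to
    \<open>z\<close> with respect to \<open>H\<close>.\<close>
  obtain u where u: "u \<noteq> 0" "orthogonal (H *v z) u"
    using orthogonal_to_vector_exists[of "H *v z"] assms(1) by auto
  then have "bil H u z = 0" by (simp add: bil_def orthogonal_def inner_commute)
  then have "a * bil H w u = 0" for w using assms(5)[of w u] by simp
  then show "a = 0" using bil_nondegenerate[OF assms(3), of u] u(1) by auto
  then show "b = 0" using assms(5)[of z z] assms(4) by simp
qed

lemma lorentzian_form_invertible:
  fixes H :: "real^'n::finite^'n"
  assumes "lorentzian_form H"
  shows "invertible H"
proof -
  obtain P :: "real^'n^'n" and i0 where
    "transpose P ** H ** P = (\<chi> i j. if i \<noteq> j then 0 else if i = i0 then -1 else 1)" (is "_ = ?D")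
    using assms unfolding lorentzian_form_def by blast
  moreover have "det ?D \<noteq> 0" by (subst det_diagonal) auto
  ultimately have "det H \<noteq> 0" by (auto simp: det_mul dest: arg_cong[where f = det])
  then show ?thesis by (simp add: invertible_det_nz)
qed

text \<open>The metric contributes the trace of the identity, and the squared covector contributes
  \<open>bil H z z\<close>, which is -1.\<close>

lemma trace_perfect_fluid:
  fixes H :: "real^'n::finite^'n" and a b :: real
  assumes "transpose H = H" "invertible H" "bil H z z = -1"
  shows "(\<Sum>i\<in>UNIV. \<Sum>j\<in>UNIV. matrix_inv H $ i $ j *
      (a *\<^sub>R H + b *\<^sub>R covector_tensor (H *v z) (H *v z)) $ i $ j) = CARD('n) * a - b"
proof -
  have "H $ i $ j = H $ j $ i" for i j
    using assms(1) by (metis transpose_def vec_lambda_beta)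
  then have "(\<Sum>i\<in>UNIV. \<Sum>j\<in>UNIV. matrix_inv H $ i $ j * H $ i $ j) = trace (matrix_inv H ** H)"
    by (simp add: trace_def matrix_matrix_mult_def)
  then have 1: "(\<Sum>i\<in>UNIV. \<Sum>j\<in>UNIV. matrix_inv H $ i $ j * H $ i $ j) = CARD('n)"
    by (simp add: matrix_inv_cancel assms(2) trace_I)
  have "(\<Sum>i\<in>UNIV. \<Sum>j\<in>UNIV. matrix_inv H $ i $ j * covector_tensor (H *v z) (H *v z) $ i $ j) =
      bil (matrix_inv H) (H *v z) (H *v z)"
    by (simp add: bil_expand covector_tensor_def mult_ac)
  also have "\<dots> = bil H z z"
    by (simp add: bil_def matrix_vector_mul_assoc matrix_inv_cancel assms(2) inner_commute)
  finally show ?thesis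
    using 1 assms(3) by (simp add: algebra_simps sum.distrib flip: sum_distrib_left)
qed

section \<open>Passage from the manifold to a chart\<close>

lemma chart_inv_left:
  assumes "chart_on X c" "q \<in> fst c"
  shows "chart_inv c (snd c q) = q"
proof -
  have "fst c \<subseteq> topspace X" using assms(1) by (simp add: chart_on_def openin_subset)
  then have "inj_on (snd c) (fst c)"
    using assms(1) by (auto simp: chart_on_def homeomorphic_map_def inf_absorb2)
  then show ?thesis using assms(2) by (simp add: chart_inv_def)
qed

lemma in_chart_apply:
  "chart_on X c \<Longrightarrow> q \<in> fst c \<Longrightarrow> in_chart c f (snd c q) = f q"
  by (simp add: in_chart_def chart_inv_left)

lemma lorentzian_manifold_chart:
  assumes "lorentzian_manifold X A g" "c \<in> A"
  shows "smooth_metric (snd c ` fst c) (in_chart c (g c))" "chart_on X c"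
proof -
  show c: "chart_on X c" using assms by (simp add: lorentzian_manifold_def smooth_manifold_def)
  show "smooth_metric (snd c ` fst c) (in_chart c (g c))"
  proof
    show "open (snd c ` fst c)" using c by (simp add: chart_on_def)
    show "smooth_on (snd c ` fst c) (in_chart c (g c))"
      using assms by (simp add: lorentzian_manifold_def smooth_tensor2_def)
    have "lorentzian_form (in_chart c (g c) y)" if "y \<in> snd c ` fst c" for y
      using that assms c by (auto simp: in_chart_apply lorentzian_manifold_def)
    then show "transpose (in_chart c (g c) y) = in_chart c (g c) y" "invertible (in_chart c (g c) y)"
      if "y \<in> snd c ` fst c" for y
      using that by (auto simp: lorentzian_form_invertible lorentzian_form_def)
  qed
qed

section \<open>Consequences of the soliton equation\<close>

lemma yamabe_unit_imp_killing:
  assumes man: "lorentzian_manifold X A g" and "unit_timelike A g Z"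
    and "almost_yamabe_soliton X A g Z k lam"
  shows "killing_field A g Z"
  unfolding killing_field_def
proof (intro conjI ballI)
  show "smooth_vector_field A Z" using assms(3) by (simp add: almost_yamabe_soliton_def)
  fix c q assume c: "c \<in> A" and q: "q \<in> fst c"
  let ?S = "snd c ` fst c" and ?G = "in_chart c (g c)" and ?Z = "in_chart c (Z c)" and ?x = "snd c q"
  interpret smooth_metric ?S ?G by (rule lorentzian_manifold_chart[OF man c])
  have ch: "chart_on X c" using lorentzian_manifold_chart[OF man c] by simp
  have x: "?x \<in> ?S" using q by simp
  have sZ: "smooth_on ?S ?Z"
    using assms(3) c by (simp add: almost_yamabe_soliton_def smooth_vector_field_def)
  note d = smooth_on_imp_differentiable[OF _ x]
  \<comment> \<open>Both bracket terms vanish since [Z,Z] = 0; what remains is the derivative of the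
    constant -1.\<close>
  have "bil (lie_deriv2 Z g c q) (?Z ?x) (?Z ?x) = dir_deriv ?Z (\<lambda>y. bil (?G y) (?Z y) (?Z y)) ?x"
    unfolding lie_deriv2_def
    by (simp add: local_lie_deriv2_apply d smooth_G sZ lie_bracket_def) (simp add: bil_def)
  also have "\<dots> = dir_deriv ?Z (\<lambda>_. -1 :: real) ?x"
    by (rule dir_deriv_cong[OF open_S x])
       (use assms(2) c ch in \<open>auto simp: unit_timelike_def in_chart_apply\<close>)
  finally have "bil (lie_deriv2 Z g c q) (Z c q) (Z c q) = 0"
    by (simp add: in_chart_apply[OF ch q])
  moreover have eq: "(k q / 2) *\<^sub>R lie_deriv2 Z g c q = (scalar_curv g c q - lam q) *\<^sub>R g c q"
    using assms(3) c q by (simp add: almost_yamabe_soliton_def)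
  then have "k q / 2 * bil (lie_deriv2 Z g c q) (Z c q) (Z c q) =
      (scalar_curv g c q - lam q) * bil (g c q) (Z c q) (Z c q)"
    by (simp flip: bil_scaleR)
  ultimately have "scalar_curv g c q - lam q = 0"
    using assms(2) c q by (simp add: unit_timelike_def)
  \<comment> \<open>With the right-hand side of the soliton equation now zero, dividing by
    \<open>k q / 2\<close> gives the Killing equation.\<close>
  moreover have "k q \<noteq> 0"
    using assms(1,3) c q by (auto simp: almost_yamabe_soliton_def lorentzian_manifold_def smooth_manifold_def)
  ultimately show "lie_deriv2 Z g c q = 0" using eq by simp
qed

lemma killing_field_chart:
  assumes "lorentzian_manifold X A g" "killing_field A g Z" "c \<in> A"
  shows "killing_metric (snd c ` fst c) (in_chart c (g c)) (in_chart c (Z c))"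
  unfolding killing_metric_def killing_metric_axioms_def
  using lorentzian_manifold_chart(1)[OF assms(1,3)] assms(2,3)
  by (auto simp: killing_field_def smooth_vector_field_def lie_deriv2_def)

text \<open>Along an integral curve the velocity is \<open>Z\<close> composed with the curve, so by
  the chain rule its acceleration is \<nabla>_Z Z.\<close>

lemma integral_curve_geodesic:
  assumes man: "lorentzian_manifold X A g" and smooth: "smooth_vector_field A Z"
    and zero: "\<And>c x. c \<in> A \<Longrightarrow> x \<in> snd c ` fst c \<Longrightarrow> cov_deriv (in_chart c (g c)) (in_chart c (Z c)) (in_chart c (Z c)) x = 0"
    and curve: "integral_curve X A Z I \<gamma>"
  shows "geodesic X A g I \<gamma>"
  unfolding geodesic_def
proof (intro conjI ballI impI)
  show "smooth_curve X A I \<gamma>" using curve by (simp add: integral_curve_def)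
  fix c t assume c: "c \<in> A" and t: "t \<in> I" "\<gamma> t \<in> fst c"
  have ch: "chart_on X c" using lorentzian_manifold_chart[OF man c] by simp
  let ?Z = "in_chart c (Z c)" and ?x = "snd c (\<gamma> t)"
  \<comment> \<open>The times spent in the chart. Openness of this set lets the velocity be replaced
    by \<open>Z\<close> along the curve before differentiating at \<open>t\<close>.\<close>
  define J where "J = {s \<in> I. \<gamma> s \<in> fst c}"
  have "open I" "continuous_map (top_of_set I) X \<gamma>" "smooth_on J (snd c \<circ> \<gamma>)"
    using curve c by (auto simp: integral_curve_def smooth_curve_def J_def)
  moreover have "openin X (fst c)" using ch by (simp add: chart_on_def)
  ultimately have "openin (top_of_set I) J"
    using openin_continuous_map_preimage[of "top_of_set I" X \<gamma> "fst c"] by (simp add: J_def)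
  then have J: "open J" using \<open>open I\<close> openin_open_trans by blast
  have tJ: "t \<in> J" using t by (simp add: J_def)
  have v: "velocity c \<gamma> s = ?Z ((snd c \<circ> \<gamma>) s)" if "s \<in> J" for s
    using curve c that by (simp add: integral_curve_def J_def in_chart_apply[OF ch])
  have "((snd c \<circ> \<gamma>) has_vector_derivative velocity c \<gamma> t) (at t)"
    unfolding velocity_def
    using smooth_on_imp_differentiable[OF \<open>smooth_on J (snd c \<circ> \<gamma>)\<close> tJ] vector_derivative_works by blast
  moreover have "?Z differentiable (at ?x)"
    using smooth c t by (auto simp: smooth_vector_field_def intro!: smooth_on_imp_differentiable)
  then have "(?Z has_derivative frechet_derivative ?Z (at ?x)) (at ((snd c \<circ> \<gamma>) t) within (snd c \<circ> \<gamma>) ` UNIV)"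
    by (auto simp: frechet_derivative_works intro: has_derivative_at_withinI)
  ultimately have "((?Z \<circ> (snd c \<circ> \<gamma>)) has_vector_derivative frechet_derivative ?Z (at ?x) (velocity c \<gamma> t)) (at t)"
    by (rule vector_derivative_diff_chain_within)
  then have "(velocity c \<gamma> has_vector_derivative frechet_derivative ?Z (at ?x) (velocity c \<gamma> t)) (at t)"
    by (rule has_vector_derivative_transform_within_open[OF _ J tJ]) (simp add: v)
  then have "acceleration g c \<gamma> t = cov_deriv (in_chart c (g c)) ?Z ?Z ?x"
    by (simp add: acceleration_def vector_derivative_at cov_deriv_def dir_deriv_def v[OF tJ])
  then show "acceleration g c \<gamma> t = 0" using zero c t by simp
qed

lemma killing_perfect_fluid_invariant:
  fixes A :: "('a, 'n::finite) chart set"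
  assumes card: "CARD('n) \<ge> 2" and man: "lorentzian_manifold X A g"
    and kill: "killing_field A g \<rho>" and unit: "unit_timelike A g \<rho>"
    and smooth: "smooth_fun A \<alpha>" "smooth_fun A \<beta>"
    and ric: "\<And>c q. c \<in> A \<Longrightarrow> q \<in> fst c \<Longrightarrow>
      ricci g c q = \<alpha> q *\<^sub>R g c q + \<beta> q *\<^sub>R covector_tensor (flat g \<rho> c q) (flat g \<rho> c q)"
    and c: "c \<in> A" and q: "q \<in> fst c"
  shows "lie_deriv0 \<rho> \<alpha> c q = 0" "lie_deriv0 \<rho> \<beta> c q = 0"
proof -
  define S where "S = snd c ` fst c"
  define G where "G = in_chart c (g c)"
  define Z where "Z = in_chart c (\<rho> c)"
  define a where "a = in_chart c \<alpha>"
  define b where "b = in_chart c \<beta>"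
  define x where "x = snd c q"
  interpret killing_metric S G Z
    unfolding S_def G_def Z_def by (rule killing_field_chart[OF man kill c])
  have ch: "chart_on X c" using lorentzian_manifold_chart[OF man c] by simp
  have x: "x \<in> S" using q by (simp add: x_def S_def)
  note d = smooth_on_imp_differentiable[OF _ x]
  have ab: "smooth_on S a" "smooth_on S b"
    using smooth c by (simp_all add: smooth_fun_def a_def b_def S_def)
  have unit': "bil (G y) (Z y) (Z y) = -1" if "y \<in> S" for y
    using that unit c by (auto simp: S_def G_def Z_def in_chart_apply[OF ch] unit_timelike_def)
  have ric': "bil (local_ricci G y) u v = a y * bil (G y) u v + b y * (bil (G y) u (Z y) * bil (G y) v (Z y))"
    if y: "y \<in> S" for y u v
  proof -
    obtain q where q: "q \<in> fst c" "y = snd c q" using y by (auto simp: S_def)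
    have "local_ricci G y = a y *\<^sub>R G y + b y *\<^sub>R covector_tensor (G y *v Z y) (G y *v Z y)"
      using ric[OF c q(1)] q by (simp add: ricci_def G_def a_def b_def Z_def in_chart_apply[OF ch] flat_def)
    then show ?thesis
      by (simp add: bil_add bil_scaleR bil_covector_tensor) (simp add: bil_def inner_commute)
  qed
  \<comment> \<open>The Ricci form on constant fields is differentiated along \<open>Z\<close> twice
    over: by invariance, and by the product rule applied to the perfect fluid form.\<close>
  have "dir_deriv Z a x * bil (G x) u v + dir_deriv Z b x * (bil (G x) u (Z x) * bil (G x) v (Z x)) = 0" for u v
  proof -
    define U where "U = (\<lambda>_::real^'n. u)"
    define V where "V = (\<lambda>_::real^'n. v)"
    have s: "smooth_on S U" "smooth_on S V" by (simp_all add: U_def V_def smooth_on_const)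
    note sm = smooth_on_bil smooth_on_mult open_S smooth_G smooth_Z ab s
    have "dir_deriv Z (\<lambda>y. bil (local_ricci G y) (U y) (V y)) x =
        dir_deriv Z (\<lambda>y. a y * bil (G y) (U y) (V y) + b y * (bil (G y) (U y) (Z y) * bil (G y) (V y) (Z y))) x"
      by (rule dir_deriv_cong[OF open_S x]) (rule ric')
    also have "\<dots> = dir_deriv Z (\<lambda>y. a y * bil (G y) (U y) (V y)) x
        + dir_deriv Z (\<lambda>y. b y * (bil (G y) (U y) (Z y) * bil (G y) (V y) (Z y))) x"
      by (intro dir_deriv_add d sm)
    also have "\<dots> = a x * dir_deriv Z (\<lambda>y. bil (G y) (U y) (V y)) x + dir_deriv Z a x * bil (G x) u v
        + b x * (bil (G x) u (Z x) * dir_deriv Z (\<lambda>y. bil (G y) (V y) (Z y)) x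
           + dir_deriv Z (\<lambda>y. bil (G y) (U y) (Z y)) x * bil (G x) v (Z x))
        + dir_deriv Z b x * (bil (G x) u (Z x) * bil (G x) v (Z x))"
      by (simp add: dir_deriv_mult d sm) (simp add: U_def V_def)
    \<comment> \<open>As [Z,Z] = 0, the pairings with \<open>Z\<close> contribute brackets of
      \<open>U\<close> and \<open>V\<close> only. All bracket terms then cancel against those from
      \<open>dir_deriv_ricci\<close>, leaving the derivatives of \<open>a\<close> and
      \<open>b\<close>.\<close>
    finally show ?thesis
      by (simp add: dir_deriv_ricci[OF x] dir_deriv_metric[OF x] sm ric'[OF x] lie_bracket_def[of Z Z])
         (simp add: U_def V_def bil_def algebra_simps)
  qed
  from metric_covector_independent[OF card sym_G[OF x] inv_G[OF x] unit'[OF x] this]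
  show "lie_deriv0 \<rho> \<alpha> c q = 0" "lie_deriv0 \<rho> \<beta> c q = 0"
    by (simp_all add: lie_deriv0_def a_def b_def Z_def x_def)
qed

text \<open>Independence of the metric and the squared covector allows comparison of coefficients:
  \<kappa>p = a - R/2 and \<kappa>(p + \<sigma>) = b. Inserting R = na - b, with n the dimension,
  and solving gives the formulas.\<close>

lemma einstein_perfect_fluid_coefficients:
  fixes H :: "real^'n::finite^'n"
  assumes "CARD('n) \<ge> 2" "transpose H = H" "invertible H" "bil H z z = -1" "\<kappa> \<noteq> 0"
    and ric: "Ric = a *\<^sub>R H + b *\<^sub>R covector_tensor (H *v z) (H *v z)"
    and R: "R = (\<Sum>i\<in>UNIV. \<Sum>j\<in>UNIV. matrix_inv H $ i $ j * Ric $ i $ j)"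
    and eq: "Ric - (R / 2) *\<^sub>R H = \<kappa> *\<^sub>R ((p + \<sigma>) *\<^sub>R covector_tensor (H *v z) (H *v z) + p *\<^sub>R H)"
  shows "p = ((1 - CARD('n) / 2) / \<kappa>) * a + (1 / (2 * \<kappa>)) * b"
    and "\<sigma> = ((CARD('n) / 2 - 1) / \<kappa>) * a + (1 / (2 * \<kappa>)) * b"
proof -
  have R': "R = CARD('n) * a - b"
    unfolding R ric by (rule trace_perfect_fluid) (use assms in auto)
  have "(a - R / 2 - \<kappa> * p) *\<^sub>R H + (b - \<kappa> * (p + \<sigma>)) *\<^sub>R covector_tensor (H *v z) (H *v z) = 0"
    using eq unfolding ric by (simp add: algebra_simps)
  then have "bil ((a - R / 2 - \<kappa> * p) *\<^sub>R H + (b - \<kappa> * (p + \<sigma>)) *\<^sub>R covector_tensor (H *v z) (H *v z)) u v = 0" for u v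
    by (simp add: bil_def)
  then have "(a - R / 2 - \<kappa> * p) * bil H u v + (b - \<kappa> * (p + \<sigma>)) * (bil H u z * bil H v z) = 0" for u v
    by (simp add: bil_add bil_scaleR bil_covector_tensor) (simp add: bil_def inner_commute)
  from metric_covector_independent[OF assms(1-4) this]
  have "a - R / 2 - \<kappa> * p = 0" "b - \<kappa> * (p + \<sigma>) = 0" .
  then have "\<kappa> * p = a - R / 2" "\<kappa> * \<sigma> = b - (a - R / 2)"
    by (simp_all add: distrib_left)
  then have "p = (a - R / 2) / \<kappa>" "\<sigma> = (b - (a - R / 2)) / \<kappa>"
    using assms(5) by (metis nonzero_mult_div_cancel_left)+
  then show "p = ((1 - CARD('n) / 2) / \<kappa>) * a + (1 / (2 * \<kappa>)) * b"
    "\<sigma> = ((CARD('n) / 2 - 1) / \<kappa>) * a + (1 / (2 * \<kappa>)) * b"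
    unfolding R' using assms(5) by (simp_all add: field_simps)
qed

theorem theorem1p2:
  fixes X :: "'a topology"
    and A :: "('a, 'n::finite) chart set"
    and g :: "('a, 'n) tensor2"
    and \<rho> :: "('a, 'n) vfield"
    and \<kappa> :: real
    and \<sigma> p k lam :: "'a \<Rightarrow> real"
  assumes "CARD('n) \<ge> 3"
    and "perfect_fluid X A g \<rho>"
    and "\<kappa> \<noteq> 0" and "smooth_fun A \<sigma>" and "smooth_fun A p"
    and "einstein_field_eq A g \<kappa> (energy_momentum g \<rho> \<sigma> p)"
    and "almost_yamabe_soliton X A g \<rho> k lam"
  shows "(\<forall>I \<gamma>. integral_curve X A \<rho> I \<gamma> \<longrightarrow> geodesic X A g I \<gamma>) \<and>
         stationary A g \<and>
         (\<forall>c\<in>A. \<forall>q\<in>fst c. lie_deriv0 \<rho> \<sigma> c q = 0 \<and> lie_deriv0 \<rho> p c q = 0)"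
proof (intro conjI allI impI ballI)
  have man: "lorentzian_manifold X A g" and smooth: "smooth_vector_field A \<rho>"
    and unit: "unit_timelike A g \<rho>"
    using assms(2) by (simp_all add: perfect_fluid_def)
  have kill: "killing_field A g \<rho>"
    by (rule yamabe_unit_imp_killing[OF man unit assms(7)])
  \<comment> \<open>The velocity field itself is the timelike Killing field.\<close>
  show "stationary A g"
    unfolding stationary_def using kill unit by (auto simp: unit_timelike_def intro!: exI[of _ \<rho>])
  show "geodesic X A g I \<gamma>" if "integral_curve X A \<rho> I \<gamma>" for I \<gamma>
  proof (rule integral_curve_geodesic[OF man smooth _ that])
    fix c x assume c: "c \<in> A" and x: "x \<in> snd c ` fst c"
    show "cov_deriv (in_chart c (g c)) (in_chart c (\<rho> c)) (in_chart c (\<rho> c)) x = 0"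
      by (rule killing_metric.cov_deriv_self_eq_0[OF killing_field_chart[OF man kill c] x])
         (use unit c in \<open>auto simp: unit_timelike_def in_chart_apply[OF lorentzian_manifold_chart(2)[OF man c]]\<close>)
  qed
  obtain \<alpha> \<beta> where ab: "smooth_fun A \<alpha>" "smooth_fun A \<beta>"
    and ric: "\<And>c q. c \<in> A \<Longrightarrow> q \<in> fst c \<Longrightarrow>
      ricci g c q = \<alpha> q *\<^sub>R g c q + \<beta> q *\<^sub>R covector_tensor (flat g \<rho> c q) (flat g \<rho> c q)"
    using assms(2) unfolding perfect_fluid_def by blast
  fix c q assume c: "c \<in> A" and q: "q \<in> fst c"
  have card: "CARD('n) \<ge> 2" using assms(1) by simp
  note ch = lorentzian_manifold_chart(2)[OF man c]
  interpret smooth_metric "snd c ` fst c" "in_chart c (g c)" by (rule lorentzian_manifold_chart(1)[OF man c])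
  have d: "in_chart c f differentiable (at (snd c q))" if "smooth_fun A f" for f
    using that c q by (auto simp: smooth_fun_def intro!: smooth_on_imp_differentiable)
  \<comment> \<open>Established on the whole chart domain and not just at \<open>q\<close>, because
    these relations are differentiated next.\<close>
  have coeff: "p r = ((1 - CARD('n) / 2) / \<kappa>) * \<alpha> r + (1 / (2 * \<kappa>)) * \<beta> r"
    "\<sigma> r = ((CARD('n) / 2 - 1) / \<kappa>) * \<alpha> r + (1 / (2 * \<kappa>)) * \<beta> r" if r: "r \<in> fst c" for r
  proof -
    have H: "transpose (g c r) = g c r" "invertible (g c r)" "bil (g c r) (\<rho> c r) (\<rho> c r) = -1"
      using sym_G[of "snd c r"] inv_G[of "snd c r"] unit c r by (simp_all add: in_chart_apply[OF ch] unit_timelike_def)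
    have R: "scalar_curv g c r = (\<Sum>i\<in>UNIV. \<Sum>j\<in>UNIV. matrix_inv (g c r) $ i $ j * ricci g c r $ i $ j)"
      by (simp add: scalar_curv_def local_scalar_def ricci_def in_chart_apply[OF ch r])
    have eq: "ricci g c r - (scalar_curv g c r / 2) *\<^sub>R g c r =
        \<kappa> *\<^sub>R ((p r + \<sigma> r) *\<^sub>R covector_tensor (g c r *v \<rho> c r) (g c r *v \<rho> c r) + p r *\<^sub>R g c r)"
      using assms(6) c r by (simp add: einstein_field_eq_def energy_momentum_def flat_def)
    show "p r = ((1 - CARD('n) / 2) / \<kappa>) * \<alpha> r + (1 / (2 * \<kappa>)) * \<beta> r"
      "\<sigma> r = ((CARD('n) / 2 - 1) / \<kappa>) * \<alpha> r + (1 / (2 * \<kappa>)) * \<beta> r"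
      using einstein_perfect_fluid_coefficients[OF card H assms(3) ric[OF c r, unfolded flat_def] R eq] by simp_all
  qed
  \<comment> \<open>The coefficients \<open>s\<close> and \<open>t\<close> are constants, so any
    such combination inherits invariance from \<alpha> and \<beta>; \<open>coeff\<close> puts both
    \<sigma> and \<open>p\<close> in this form.\<close>
  have lin: "lie_deriv0 \<rho> f c q = 0" if f: "\<And>r. r \<in> fst c \<Longrightarrow> f r = s * \<alpha> r + t * \<beta> r" for f s t
  proof -
    have "lie_deriv0 \<rho> f c q = dir_deriv (in_chart c (\<rho> c)) (\<lambda>y. s * in_chart c \<alpha> y + t * in_chart c \<beta> y) (snd c q)"
      unfolding lie_deriv0_def
      by (rule dir_deriv_cong[OF open_S]) (use q f in \<open>auto simp: in_chart_apply[OF ch]\<close>)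
    also have "\<dots> = s * lie_deriv0 \<rho> \<alpha> c q + t * lie_deriv0 \<rho> \<beta> c q"
      by (simp add: dir_deriv_add dir_deriv_mult d ab lie_deriv0_def)
    finally show ?thesis
      using killing_perfect_fluid_invariant[OF card man kill unit ab ric c q] by simp
  qed
  show "lie_deriv0 \<rho> \<sigma> c q = 0" "lie_deriv0 \<rho> p c q = 0"
    using lin coeff by blast+
qed

end
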